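(* Let $(K;S)$ be a topological dynamical system with $S$ left amenable and consider the following assertions. (i) $(K;S)$ is weak* mean ergodic. (ii) $(K;S)$ is norm mean ergodic. (iii) $(K;S)$ is uniquely ergodic. Then (iii) $\Rightarrow$ (ii) $\Rightarrow$ (i). If $(K;S)$ is topologically transitive, i.e. there is $x\in K$ with $\overline{Sx}=K$, then all these assertions are equivalent.
   Context: Compact spaces are Hausdorff; vector spaces are complex. A semitopological semigroup $S$ (separately continuous multiplication) is left amenable if $\mathrm{C}_{\mathrm{b}}(S)$ (bounded continuous functions) has a left invariant mean: a positive $m\in\mathrm{C}_{\mathrm{b}}(S)'$ with $m(\mathbf{1})=1$ and $m(L_sf)=m(f)$ for all $f,s$, where $L_sf(t)=f(st)$. A topological dynamical system $(K;S)$ is a compact space $K$ with a semitopological semigroup $S$ acting on $K$ such that $S\times K\to K$ is continuous. Koopman semigroup: $\mathcal{T}_S=\{T_s\mid s\in S\}\subset\mathscr{L}(\mathrm{C}(K))$, $T_sf(x)=f(sx)$; $\mathcal{T}_S'=\{T_s'\mid s\in S\}$ on $\mathrm{C}(K)'$ (regular Borel measures). For a semigroup $\mathcal{S}$ of continuous operators on a locally convex space $Y$, a net $(T_\alpha)$ in the closure of $\mathrm{co}\,\mathcal{S}$ in $Y^Y$ (product topology) is left (resp. right) ergodic for $\mathcal{S}$ if $\lim_\alpha(\mathrm{Id}-T)T_\alpha y=0$ (resp. $\lim_\alpha T_\alpha(\mathrm{Id}-T)y=0$) for each $y\in Y$, $T\in\mathcal{S}$; $\mathcal{S}$ is left (resp.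 right) mean ergodic if each left (resp. right) ergodic net converges pointwise on $Y$. $(K;S)$ is weak* mean ergodic if $\mathcal{T}_S'$ is left mean ergodic on $\mathrm{C}(K)'$ with the weak* topology $\sigma(\mathrm{C}(K)',\mathrm{C}(K))$; norm mean ergodic if $\mathcal{T}_S$ is right mean ergodic on $\mathrm{C}(K)$ with the norm topology; uniquely ergodic if there is a unique $S$-invariant probability measure $\mu\in\mathrm{C}(K)'$ (i.e. $T_s'\mu=\mu$ for all $s\in S$). *)

theory Defs
  imports "HOL-Analysis.Analysis" "HOL-Probability.Probability_Measure"
begin

section \<open>Spaces of bounded continuous functions and their duals\<close>

text \<open>
  The space of bounded continuous complex functions on \<open>'a\<close> with the supremum norm is the library
  type \<^typ>\<open>'a \<Rightarrow>\<^sub>C complex\<close>; for compact \<open>'a\<close> it is the space of all continuous functions.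
  The library only provides its real vector space structure. Note that \<^term>\<open>Bcontfun\<close> is only
  meaningful on bounded continuous functions; the lemmas below show that it is applied to such
  functions in all cases of interest.
\<close>

definition scaleC_bcontfun :: "complex \<Rightarrow> ('a::topological_space \<Rightarrow>\<^sub>C complex) \<Rightarrow> ('a \<Rightarrow>\<^sub>C complex)"
  where "scaleC_bcontfun c f = Bcontfun (\<lambda>x. c * apply_bcontfun f x)"

lemma apply_scaleC_bcontfun [simp]:
  "apply_bcontfun (scaleC_bcontfun c f) x = c * apply_bcontfun f x"
proof -
  have "(\<lambda>x. c * apply_bcontfun f x) \<in> bcontfun"
    by (intro bcontfun_normI[where b = "norm c * norm f"] continuous_intros)
       (auto simp: norm_mult intro: mult_left_mono norm_bounded)
  then show ?thesis
    by (simp add: scaleC_bcontfun_def Bcontfun_inverse)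
qed

definition comp_bcontfun ::
    "('b::topological_space \<Rightarrow>\<^sub>C 'c::real_normed_vector) \<Rightarrow> ('a::topological_space \<Rightarrow> 'b) \<Rightarrow> ('a \<Rightarrow>\<^sub>C 'c)"
  where "comp_bcontfun f g = Bcontfun (\<lambda>x. apply_bcontfun f (g x))"

lemma apply_comp_bcontfun:
  assumes "continuous_on UNIV g"
  shows "apply_bcontfun (comp_bcontfun f g) x = apply_bcontfun f (g x)"
proof -
  have "(\<lambda>x. apply_bcontfun f (g x)) \<in> bcontfun"
    using assms
    by (intro bcontfun_normI[where b = "norm f"] norm_bounded
          continuous_on_compose2[of UNIV "apply_bcontfun f" UNIV g]) auto
  then show ?thesis
    by (simp add: comp_bcontfun_def Bcontfun_inverse)
qed

typedef (overloaded) 'a cb_dual =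
  "{\<phi> :: ('a::topological_space \<Rightarrow>\<^sub>C complex) \<Rightarrow> complex.
      (\<forall>f g. \<phi> (f + g) = \<phi> f + \<phi> g) \<and> (\<forall>c f. \<phi> (scaleC_bcontfun c f) = c * \<phi> f) \<and>
      (\<exists>B. \<forall>f. norm (\<phi> f) \<le> B * norm f)}"
  morphisms apply_dual Abs_dual
  by (rule exI[of _ "\<lambda>_. 0"]) (auto intro: exI[of _ 0])

lemma apply_dual_add: "apply_dual \<mu> (f + g) = apply_dual \<mu> f + apply_dual \<mu> g"
  and apply_dual_scaleC: "apply_dual \<mu> (scaleC_bcontfun c f) = c * apply_dual \<mu> f"
  and apply_dual_bounded: "\<exists>B. \<forall>f. norm (apply_dual \<mu> f) \<le> B * norm f"
  using apply_dual[of \<mu>] by auto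

lemma apply_dual_Abs_dual:
  assumes "\<And>f g. \<phi> (f + g) = \<phi> f + \<phi> g" "\<And>c f. \<phi> (scaleC_bcontfun c f) = c * \<phi> f"
    and "\<And>f. norm (\<phi> f) \<le> B * norm f"
  shows "apply_dual (Abs_dual \<phi>) = \<phi>"
  using assms by (intro Abs_dual_inverse) blast

lemma cb_dual_eqI: "(\<And>f. apply_dual \<mu> f = apply_dual \<nu> f) \<Longrightarrow> \<mu> = \<nu>"
  by (metis apply_dual_inject ext)

instantiation cb_dual :: (topological_space) real_vector
begin

definition "0 = Abs_dual (\<lambda>_. 0)"
definition "\<mu> + \<nu> = Abs_dual (\<lambda>f. apply_dual \<mu> f + apply_dual \<nu> f)"
definition "- \<mu> = Abs_dual (\<lambda>f. - apply_dual \<mu> f)"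
definition "\<mu> - \<nu> = Abs_dual (\<lambda>f. apply_dual \<mu> f - apply_dual \<nu> f)"
definition "r *\<^sub>R \<mu> = Abs_dual (\<lambda>f. r *\<^sub>R apply_dual \<mu> f)"

lemma apply_dual_zero [simp]: "apply_dual (0 :: 'a cb_dual) f = 0"
proof -
  have "apply_dual (Abs_dual (\<lambda>_. 0) :: 'a cb_dual) = (\<lambda>_. 0)"
    by (rule apply_dual_Abs_dual[where B = 0]) auto
  then show ?thesis by (simp add: zero_cb_dual_def)
qed

lemma apply_dual_plus [simp]: "apply_dual (\<mu> + \<nu>) f = apply_dual \<mu> f + apply_dual \<nu> f"
proof -
  obtain B C where "\<And>f. norm (apply_dual \<mu> f) \<le> B * norm f" "\<And>f. norm (apply_dual \<nu> f) \<le> C * norm f"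
    using apply_dual_bounded by metis
  then have "norm (apply_dual \<mu> f + apply_dual \<nu> f) \<le> (B + C) * norm f" for f
    by (metis add_mono distrib_right norm_triangle_le)
  then have "apply_dual (Abs_dual (\<lambda>f. apply_dual \<mu> f + apply_dual \<nu> f)) =
      (\<lambda>f. apply_dual \<mu> f + apply_dual \<nu> f)"
    by (intro apply_dual_Abs_dual[where B = "B + C"])
       (simp_all add: apply_dual_add apply_dual_scaleC distrib_left)
  then show ?thesis by (simp add: plus_cb_dual_def)
qed

lemma apply_dual_scaleR [simp]: "apply_dual (r *\<^sub>R \<mu>) f = r *\<^sub>R apply_dual \<mu> f"
proof -
  obtain B where "\<And>f. norm (apply_dual \<mu> f) \<le> B * norm f"
    using apply_dual_bounded by metis
  then have "norm (r *\<^sub>R apply_dual \<mu> f) \<le> (\<bar>r\<bar> * B) * norm f" for f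
    by (simp add: mult.assoc mult_left_mono)
  then have "apply_dual (Abs_dual (\<lambda>f. r *\<^sub>R apply_dual \<mu> f)) = (\<lambda>f. r *\<^sub>R apply_dual \<mu> f)"
    by (intro apply_dual_Abs_dual[where B = "\<bar>r\<bar> * B"])
       (simp_all add: apply_dual_add apply_dual_scaleC scaleR_add_right)
  then show ?thesis by (simp add: scaleR_cb_dual_def)
qed

lemma uminus_cb_dual_eq: "- \<mu> = (-1) *\<^sub>R (\<mu> :: 'a cb_dual)"
  by (simp add: uminus_cb_dual_def scaleR_cb_dual_def)

lemma minus_cb_dual_eq: "\<mu> - \<nu> = \<mu> + (-1) *\<^sub>R (\<nu> :: 'a cb_dual)"
  by (simp add: minus_cb_dual_def plus_cb_dual_def)

lemma apply_dual_uminus [simp]: "apply_dual (- \<mu>) f = - apply_dual \<mu> f"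
  by (simp add: uminus_cb_dual_eq)

lemma apply_dual_minus [simp]: "apply_dual (\<mu> - \<nu>) f = apply_dual \<mu> f - apply_dual \<nu> f"
  by (simp add: minus_cb_dual_eq)

instance
  by standard (rule cb_dual_eqI; simp add: scaleR_add_right scaleR_add_left)+

end

text \<open>The dual space carries the weak* topology throughout.\<close>

instantiation cb_dual :: (topological_space) topological_space
begin

definition open_cb_dual :: "'a cb_dual set \<Rightarrow> bool"
  where "open_cb_dual =
    generate_topology {(\<lambda>\<mu>. apply_dual \<mu> f) -` V | f V. open (V :: complex set)}"

instance
proof
  show "open (UNIV :: 'a cb_dual set)"
    unfolding open_cb_dual_def by (rule generate_topology.UNIV)
next
  fix U V :: "'a cb_dual set"
  assume "open U" "open V"
  then show "open (U \<inter> V)"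
    unfolding open_cb_dual_def by (rule generate_topology.Int)
next
  fix \<U> :: "'a cb_dual set set"
  assume "\<forall>U\<in>\<U>. open U"
  then show "open (\<Union>\<U>)"
    unfolding open_cb_dual_def by (auto intro: generate_topology.UN)
qed

end

text \<open>The adjoint \<open>T'\<close>; it has the intended meaning for bounded complex-linear operators \<open>T\<close>.\<close>

definition dual_operator ::
    "(('a::topological_space \<Rightarrow>\<^sub>C complex) \<Rightarrow> ('b::topological_space \<Rightarrow>\<^sub>C complex)) \<Rightarrow> 'b cb_dual \<Rightarrow> 'a cb_dual"
  where "dual_operator T \<mu> = Abs_dual (\<lambda>f. apply_dual \<mu> (T f))"

lemma apply_dual_operator:
  assumes "\<And>f g. T (f + g) = T f + T g" "\<And>c f. T (scaleC_bcontfun c f) = scaleC_bcontfun c (T f)"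
    and "\<And>f. norm (T f) \<le> C * norm f"
  shows "apply_dual (dual_operator T \<mu>) f = apply_dual \<mu> (T f)"
proof -
  obtain B where B: "\<And>f. norm (apply_dual \<mu> f) \<le> B * norm f"
    using apply_dual_bounded by metis
  have "norm (apply_dual \<mu> (T f)) \<le> (\<bar>B\<bar> * C) * norm f" for f
  proof -
    have "norm (apply_dual \<mu> (T f)) \<le> \<bar>B\<bar> * norm (T f)"
      by (rule order_trans[OF B]) (auto intro: mult_right_mono)
    also have "\<dots> \<le> \<bar>B\<bar> * (C * norm f)"
      by (intro mult_left_mono assms(3)) auto
    finally show ?thesis by (simp add: mult.assoc)
  qed
  then have "apply_dual (Abs_dual (\<lambda>f. apply_dual \<mu> (T f))) = (\<lambda>f. apply_dual \<mu> (T f))"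
    by (intro apply_dual_Abs_dual) (auto simp: apply_dual_add apply_dual_scaleC assms(1,2))
  then show ?thesis by (simp add: dual_operator_def)
qed


section \<open>Amenable semitopological semigroups\<close>

class semitopological_semigroup = semigroup_mult + topological_space +
  assumes open_vimage_mult_left: "open V \<Longrightarrow> open ((\<lambda>t. s * t) -` V)"
    and open_vimage_mult_right: "open V \<Longrightarrow> open ((\<lambda>t. t * s) -` V)"

lemma continuous_on_mult_fixed_left:
    "continuous_on UNIV (\<lambda>t. s * t :: 's::semitopological_semigroup)"
  and continuous_on_mult_fixed_right:
    "continuous_on UNIV (\<lambda>t. t * s :: 's::semitopological_semigroup)"
  by (simp_all add: continuous_on_open_vimage open_vimage_mult_left open_vimage_mult_right)

definition left_translation ::
    "'s::semitopological_semigroup \<Rightarrow> ('s \<Rightarrow>\<^sub>C complex) \<Rightarrow> ('s \<Rightarrow>\<^sub>C complex)"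
  where "left_translation s f = comp_bcontfun f (\<lambda>t. s * t)"

lemma apply_left_translation [simp]:
  "apply_bcontfun (left_translation s f) t = apply_bcontfun f (s * t)"
  by (simp add: left_translation_def apply_comp_bcontfun continuous_on_mult_fixed_left)

definition positive_functional :: "'a::topological_space cb_dual \<Rightarrow> bool"
  where "positive_functional m \<longleftrightarrow>
    (\<forall>f. (\<forall>x. apply_bcontfun f x \<in> \<real>\<^sub>\<ge>\<^sub>0) \<longrightarrow> apply_dual m f \<in> \<real>\<^sub>\<ge>\<^sub>0)"

definition left_invariant_mean :: "'s::semitopological_semigroup cb_dual \<Rightarrow> bool"
  where "left_invariant_mean m \<longleftrightarrow>
    positive_functional m \<and> apply_dual m (const_bcontfun 1) = 1 \<and>
    (\<forall>s f. apply_dual m (left_translation s f) = apply_dual m f)"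

definition left_amenable :: "'s::semitopological_semigroup itself \<Rightarrow> bool"
  where "left_amenable _ \<longleftrightarrow> (\<exists>m :: 's cb_dual. left_invariant_mean m)"


section \<open>Ergodic nets and mean ergodic operator semigroups\<close>

definition operator_co :: "('y::real_vector \<Rightarrow> 'y) set \<Rightarrow> ('y \<Rightarrow> 'y) set"
  where "operator_co S =
    {\<lambda>y. \<Sum>T\<in>F. c T *\<^sub>R T y | F c. finite F \<and> F \<subseteq> S \<and> (\<forall>T\<in>F. 0 \<le> c T) \<and> sum c F = 1}"

text \<open>
  Nets of operators are represented by proper filters: a net \<open>(T\<^sub>\<alpha>)\<close> corresponds to the filter
  of all sets which contain a tail of the net (\<open>section_filter\<close> below), every proper filter arises
  in this way, and all notions below only depend on this filter. In contrast to nets, filters need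
  no quantification over index types.

  Limits are taken in the topology of \<open>'y\<close>, and \<^const>\<open>closure\<close> refers to the topology of
  \<^typ>\<open>'y \<Rightarrow> 'y\<close>, which is the product topology.
\<close>

definition left_ergodic_net ::
    "('y::{real_vector, topological_space} \<Rightarrow> 'y) set \<Rightarrow> ('y \<Rightarrow> 'y) filter \<Rightarrow> bool"
  where "left_ergodic_net S F \<longleftrightarrow>
    F \<noteq> bot \<and> (\<forall>\<^sub>F A in F. A \<in> closure (operator_co S)) \<and>
    (\<forall>y. \<forall>T\<in>S. ((\<lambda>A. A y - T (A y)) \<longlongrightarrow> 0) F)"

definition right_ergodic_net ::
    "('y::{real_vector, topological_space} \<Rightarrow> 'y) set \<Rightarrow> ('y \<Rightarrow> 'y) filter \<Rightarrow> bool"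
  where "right_ergodic_net S F \<longleftrightarrow>
    F \<noteq> bot \<and> (\<forall>\<^sub>F A in F. A \<in> closure (operator_co S)) \<and>
    (\<forall>y. \<forall>T\<in>S. ((\<lambda>A. A (y - T y)) \<longlongrightarrow> 0) F)"

definition left_mean_ergodic :: "('y::{real_vector, topological_space} \<Rightarrow> 'y) set \<Rightarrow> bool"
  where "left_mean_ergodic S \<longleftrightarrow>
    (\<forall>F. left_ergodic_net S F \<longrightarrow> (\<forall>y. \<exists>l. ((\<lambda>A. A y) \<longlongrightarrow> l) F))"

definition right_mean_ergodic :: "('y::{real_vector, topological_space} \<Rightarrow> 'y) set \<Rightarrow> bool"
  where "right_mean_ergodic S \<longleftrightarrow>
    (\<forall>F. right_ergodic_net S F \<longrightarrow> (\<forall>y. \<exists>l. ((\<lambda>A. A y) \<longlongrightarrow> l) F))"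

definition directed_index :: "'i set \<Rightarrow> ('i \<Rightarrow> 'i \<Rightarrow> bool) \<Rightarrow> bool"
  where "directed_index I le \<longleftrightarrow> I \<noteq> {} \<and> (\<forall>i\<in>I. le i i) \<and>
    (\<forall>i\<in>I. \<forall>j\<in>I. \<forall>k\<in>I. le i j \<longrightarrow> le j k \<longrightarrow> le i k) \<and>
    (\<forall>i\<in>I. \<forall>j\<in>I. \<exists>k\<in>I. le i k \<and> le j k)"

definition section_filter :: "'i set \<Rightarrow> ('i \<Rightarrow> 'i \<Rightarrow> bool) \<Rightarrow> ('i \<Rightarrow> 'a) \<Rightarrow> 'a filter"
  where "section_filter I le x = (INF i\<in>I. principal (x ` {j \<in> I. le i j}))"

lemma eventually_section_filter:
  assumes "directed_index I le"
  shows "eventually P (section_filter I le x) \<longleftrightarrow> (\<exists>i\<in>I. \<forall>j\<in>I. le i j \<longrightarrow> P (x j))"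
proof -
  have "eventually P (section_filter I le x) \<longleftrightarrow>
      (\<exists>i\<in>I. eventually P (principal (x ` {j \<in> I. le i j})))"
    unfolding section_filter_def
  proof (rule eventually_INF_base)
    show "I \<noteq> {}"
      using assms by (simp add: directed_index_def)
    fix i j assume "i \<in> I" "j \<in> I"
    with assms obtain k where "k \<in> I" "le i k" "le j k"
      unfolding directed_index_def by blast
    moreover from this \<open>i \<in> I\<close> \<open>j \<in> I\<close> assms have "le i l \<and> le j l" if "l \<in> I" "le k l" for l
      using that unfolding directed_index_def by blast
    ultimately show "\<exists>k\<in>I. principal (x ` {l \<in> I. le k l}) \<le>
        inf (principal (x ` {l \<in> I. le i l})) (principal (x ` {l \<in> I. le j l}))"
      by (intro bexI[of _ k]) auto
  qed
  then show ?thesis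
    by (auto simp: eventually_principal)
qed

lemma section_filter_neq_bot:
  assumes "directed_index I le"
  shows "section_filter I le x \<noteq> bot"
proof -
  have "\<forall>i\<in>I. le i i"
    using assms by (simp add: directed_index_def)
  then show ?thesis
    unfolding trivial_limit_def eventually_section_filter[OF assms] by blast
qed

lemma proper_filter_eq_section_filter:
  fixes F :: "'a filter"
  assumes "F \<noteq> bot" "\<forall>\<^sub>F a in F. a \<in> C"
  shows "\<exists>(I :: ('a set \<times> 'a) set) le x.
    directed_index I le \<and> x ` I \<subseteq> C \<and> F = section_filter I le x"
proof -
  define I where "I = {(A, a). (\<forall>\<^sub>F b in F. b \<in> A) \<and> a \<in> A \<and> A \<subseteq> C}"
  define le :: "'a set \<times> 'a \<Rightarrow> 'a set \<times> 'a \<Rightarrow> bool" where "le = (\<lambda>p q. fst q \<subseteq> fst p)"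
  have nonempty: "\<exists>a. a \<in> A" if "\<forall>\<^sub>F b in F. b \<in> A" for A
    using eventually_happens'[OF assms(1) that] .
  have dir: "directed_index I le"
    unfolding directed_index_def
  proof (intro conjI ballI impI)
    obtain a where "a \<in> C"
      using nonempty[of C] assms(2) by auto
    then have "(C, a) \<in> I"
      using assms(2) by (simp add: I_def)
    then show "I \<noteq> {}"
      by blast
    fix p q assume "p \<in> I" "q \<in> I"
    then have ev: "\<forall>\<^sub>F b in F. b \<in> fst p \<inter> fst q" and sub: "fst p \<inter> fst q \<subseteq> C"
      by (auto simp: I_def eventually_conj_iff)
    obtain a where "a \<in> fst p \<inter> fst q"
      using nonempty[OF ev] by blast
    with ev sub have "(fst p \<inter> fst q, a) \<in> I"
      by (simp add: I_def)
    then show "\<exists>k\<in>I. le p k \<and> le q k"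
      by (rule bexI[rotated]) (simp add: le_def)
  qed (auto simp: le_def)
  have "eventually P F \<longleftrightarrow> eventually P (section_filter I le snd)" for P
  proof
    assume "eventually P F"
    with assms(2) have ev: "\<forall>\<^sub>F b in F. b \<in> {b \<in> C. P b}"
      by (simp add: eventually_conj_iff)
    obtain a where "a \<in> {b \<in> C. P b}"
      using nonempty[OF ev] by blast
    with ev have "({b \<in> C. P b}, a) \<in> I"
      by (simp add: I_def)
    then show "eventually P (section_filter I le snd)"
      unfolding eventually_section_filter[OF dir]
      by (rule bexI[rotated]) (auto simp: I_def le_def)
  next
    assume "eventually P (section_filter I le snd)"
    then obtain p where p: "p \<in> I" "\<And>q. q \<in> I \<Longrightarrow> le p q \<Longrightarrow> P (snd q)"
      unfolding eventually_section_filter[OF dir] by blast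
    have "P b" if "b \<in> fst p" for b
      using p(2)[of "(fst p, b)"] p(1) that by (auto simp: I_def le_def)
    moreover have "\<forall>\<^sub>F b in F. b \<in> fst p"
      using p(1) by (auto simp: I_def)
    ultimately show "eventually P F"
      by (rule eventually_mono[rotated])
  qed
  then have "F = section_filter I le snd"
    by (simp add: filter_eq_iff)
  moreover have "snd ` I \<subseteq> C"
    by (auto simp: I_def)
  ultimately show ?thesis
    using dir by blast
qed


section \<open>Topological dynamical systems\<close>

definition topological_dynamical_system ::
    "('s::semitopological_semigroup \<Rightarrow> 'k::t2_space \<Rightarrow> 'k) \<Rightarrow> bool"
  where "topological_dynamical_system act \<longleftrightarrow>
    compact (UNIV :: 'k set) \<and>
    (\<forall>s t x. act (s * t) x = act s (act t x)) \<and>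
    continuous_on UNIV (\<lambda>(s, x). act s x)"

definition koopman :: "('s \<Rightarrow> 'k::topological_space \<Rightarrow> 'k) \<Rightarrow> 's \<Rightarrow> ('k \<Rightarrow>\<^sub>C complex) \<Rightarrow> ('k \<Rightarrow>\<^sub>C complex)"
  where "koopman act s f = comp_bcontfun f (act s)"

lemma apply_koopman:
  assumes "topological_dynamical_system act"
  shows "apply_bcontfun (koopman act s f) x = apply_bcontfun f (act s x)"
proof -
  have "continuous_on UNIV (\<lambda>(s, x). act s x)"
    using assms by (simp add: topological_dynamical_system_def)
  moreover have "continuous_on UNIV (\<lambda>x::'b. (s, x))"
    by (intro continuous_on_Pair continuous_on_const continuous_on_id)
  ultimately have "continuous_on UNIV (\<lambda>x. case (s, x) of (s, x) \<Rightarrow> act s x)"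
    by (rule continuous_on_compose2) simp
  then show ?thesis
    by (simp add: koopman_def apply_comp_bcontfun)
qed

lemma apply_dual_koopman:
  assumes "topological_dynamical_system act"
  shows "apply_dual (dual_operator (koopman act s) \<mu>) f = apply_dual \<mu> (koopman act s f)"
proof (rule apply_dual_operator[where C = 1])
  show "norm (koopman act s f) \<le> 1 * norm f" for f
    by (rule norm_bound) (simp add: apply_koopman[OF assms] norm_bounded)
qed (rule bcontfun_eqI; simp add: apply_koopman[OF assms])+

definition koopman_semigroup ::
    "('s \<Rightarrow> 'k::topological_space \<Rightarrow> 'k) \<Rightarrow> (('k \<Rightarrow>\<^sub>C complex) \<Rightarrow> ('k \<Rightarrow>\<^sub>C complex)) set"
  where "koopman_semigroup act = range (koopman act)"

definition dual_koopman_semigroup ::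
    "('s \<Rightarrow> 'k::topological_space \<Rightarrow> 'k) \<Rightarrow> ('k cb_dual \<Rightarrow> 'k cb_dual) set"
  where "dual_koopman_semigroup act = dual_operator ` koopman_semigroup act"

definition weak_star_mean_ergodic :: "('s \<Rightarrow> 'k::topological_space \<Rightarrow> 'k) \<Rightarrow> bool"
  where "weak_star_mean_ergodic act \<longleftrightarrow> left_mean_ergodic (dual_koopman_semigroup act)"

definition norm_mean_ergodic :: "('s \<Rightarrow> 'k::topological_space \<Rightarrow> 'k) \<Rightarrow> bool"
  where "norm_mean_ergodic act \<longleftrightarrow> right_mean_ergodic (koopman_semigroup act)"

definition regular_borel_measure :: "'k::topological_space measure \<Rightarrow> bool"
  where "regular_borel_measure M \<longleftrightarrow> sets M = sets borel \<and>
    (\<forall>B\<in>sets borel. emeasure M B = (SUP C\<in>{C. compact C \<and> C \<in> sets borel \<and> C \<subseteq> B}. emeasure M C) \<and>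
                    emeasure M B = (INF U\<in>{U. open U \<and> B \<subseteq> U}. emeasure M U))"

text \<open>
  A functional on the continuous functions is a probability measure if it is integration with
  respect to a regular Borel probability measure.
\<close>

definition is_probability_measure :: "'k::topological_space cb_dual \<Rightarrow> bool"
  where "is_probability_measure \<mu> \<longleftrightarrow>
    (\<exists>M. prob_space M \<and> regular_borel_measure M \<and>
         (\<forall>f. apply_dual \<mu> f = (LINT x|M. apply_bcontfun f x)))"

definition uniquely_ergodic :: "('s \<Rightarrow> 'k::topological_space \<Rightarrow> 'k) \<Rightarrow> bool"
  where "uniquely_ergodic act \<longleftrightarrow>
    (\<exists>!\<mu>. is_probability_measure \<mu> \<and> (\<forall>s. dual_operator (koopman act s) \<mu> = \<mu>))"

definition topologically_transitive :: "('s \<Rightarrow> 'k::topological_space \<Rightarrow> 'k) \<Rightarrow> bool"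
  where "topologically_transitive act \<longleftrightarrow> (\<exists>x. closure (range (\<lambda>s. act s x)) = UNIV)"

end

theory Submission
  imports Defs
begin

text \<open>
  Write \<open>T\<^sub>s f x = f (s x)\<close>, so that \<open>T\<^sub>s T\<^sub>t = T\<^sub>t\<^sub>s\<close>, and let \<open>N\<close> be the space of coboundaries, the
  linear span of all \<open>f - T\<^sub>s f\<close>. All three assertions are about \<open>N\<close>: right ergodic nets on
  \<open>C(K)\<close> tend to \<open>0\<close> on \<open>N\<close>, left ergodic nets on the dual space tend to \<open>0\<close> on functions from the
  norm closure of \<open>N\<close>, and the invariant probability measures are the positive normalised
  functionals that vanish on \<open>N\<close>.

  To pass from unique to norm mean ergodicity, let \<open>\<mu>\<close> be the only invariant probability
  measure. If \<open>sup Re (f + h)\<close> were at least \<open>Re \<mu>(f) + \<epsilon>\<close> for all \<open>h \<in> N\<close>, the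
  Mazur-Orlicz form of the Hahn-Banach theorem (\<open>mazur_orlicz\<close>) would give a linear functional
  below \<open>sup Re\<close> that is at least \<open>Re \<mu>(f) + \<epsilon>\<close> on \<open>f + N\<close>. Such a functional vanishes on \<open>N\<close>, so
  by the Riesz representation theorem it is an invariant probability measure other than \<open>\<mu>\<close>. Hence
  \<open>Re (f + h) \<le> Re \<mu>(f) + \<epsilon>\<close> for some \<open>h \<in> N\<close> (\<open>uniquely_ergodic_upper_bound\<close>). Along a right
  ergodic net the averages of \<open>h\<close> disappear, so the averages of \<open>Re f\<close> are eventually at most
  \<open>Re \<mu>(f) + 2\<epsilon>\<close>, uniformly on \<open>K\<close>. Using this for the
  multiples of \<open>f\<close> by \<open>\<plusminus>1\<close> and \<open>\<plusminus>\<i>\<close>, the averages of \<open>f\<close> converge uniformly to the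
  constant \<open>\<mu>(f)\<close>.

  For weak* mean ergodicity a net on \<open>C(K)\<close> is needed to start with. Amenability
  provides a right ergodic net (\<open>right_ergodic_net_exists\<close>): integrating an orbit map
  \<open>s \<mapsto> \<phi>(T\<^sub>s f)\<close> against an invariant mean turns any bounded functional \<open>\<phi>\<close> into an invariant one, which vanishes on \<open>N\<close>; so \<open>0\<close> cannot be
  separated from the averages of a coboundary, and these get arbitrarily small in norm. Let \<open>P f\<close>
  be the limit of the averages of \<open>f\<close> along this net. Composing the net with \<open>T\<^sub>s\<close> gives another
  right ergodic net, and since the union of the two nets converges as well, \<open>T\<^sub>s (P f) = P f\<close>.
  Moreover \<open>f - P f\<close> lies in the closure of \<open>N\<close>. A left ergodic net of operators \<open>B\<close> on the dual
  therefore satisfies \<open>(B \<mu>)(P f) = \<mu>(P f)\<close> and \<open>(B \<mu>)(f - P f) \<longlongrightarrow> 0\<close>, so \<open>B \<mu>\<close> converges to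
  \<open>\<mu> \<circ> P\<close>.

  In a weak* mean ergodic, topologically transitive system an invariant probability
  measure exists by averaging a point evaluation. Let \<open>x\<close> have a dense orbit and let \<open>\<mu>\<close>, \<open>\<nu>\<close> be
  invariant probability measures. For an average \<open>A\<close> the function \<open>Re (A f)\<close> has \<open>\<mu>\<close>-integral
  \<open>Re \<mu>(f)\<close>, so it is smaller than \<open>Re \<mu>(f) + \<epsilon>\<close> at some point \<open>s x\<close> of the orbit, and this value
  is that of \<open>T\<^sub>s A f\<close> at \<open>x\<close>. Hence there is a right ergodic net along which \<open>Re (A f)(x)\<close> is
  at most \<open>Re \<mu>(f) + \<epsilon>\<close> (\<open>right_ergodic_net_below\<close>), and likewise one along which it is at least
  \<open>Re \<nu>(f) - \<epsilon>\<close>. The adjoints of both form one left ergodic net, which converges at the point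
  evaluation in \<open>x\<close>; thus \<open>Re \<nu>(f) \<le> Re \<mu>(f) + 2\<epsilon>\<close>, and by symmetry \<open>\<mu> = \<nu>\<close>.
\<close>

section \<open>Sublinear functionals and the Mazur-Orlicz theorem\<close>

definition sublinear :: "('v::real_vector \<Rightarrow> real) \<Rightarrow> bool" where
  "sublinear p \<longleftrightarrow> (\<forall>x y. p (x + y) \<le> p x + p y) \<and> (\<forall>t x. 0 \<le> t \<longrightarrow> p (t *\<^sub>R x) = t * p x)"

lemma sublinear_add: "sublinear p \<Longrightarrow> p (x + y) \<le> p x + p y"
  and sublinear_scale: "sublinear p \<Longrightarrow> 0 \<le> t \<Longrightarrow> p (t *\<^sub>R x) = t * p x"
  by (simp_all add: sublinear_def)

lemma sublinear_zero: "sublinear p \<Longrightarrow> p 0 = 0"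
  using sublinear_scale[of p 0 0] by simp

lemma sublinear_minus: "sublinear p \<Longrightarrow> - p (- x) \<le> p x"
  using sublinear_add[of p x "- x"] sublinear_zero[of p] by simp

lemma sublinearI:
  assumes add: "\<And>x y. p (x + y) \<le> p x + p y" and zero: "p 0 = 0"
    and scale: "\<And>t x. 0 < t \<Longrightarrow> p (t *\<^sub>R x) \<le> t * p x"
  shows "sublinear p"
  unfolding sublinear_def
proof (intro conjI allI impI add)
  fix t :: real and x assume "0 \<le> t"
  show "p (t *\<^sub>R x) = t * p x"
  proof (cases "t = 0")
    case False
    with \<open>0 \<le> t\<close> have t: "0 < t" by simp
    have "p x = p (inverse t *\<^sub>R (t *\<^sub>R x))" using t by simp
    also have "\<dots> \<le> inverse t * p (t *\<^sub>R x)" using t by (intro scale) simp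
    finally have "t * p x \<le> p (t *\<^sub>R x)" using t by (simp add: field_simps)
    with scale[OF t] show ?thesis by (intro antisym)
  qed (simp add: zero)
qed

text \<open>The functional \<open>q x = inf (p (x + t c) - t d)\<close>, over \<open>t \<ge> 0\<close> and \<open>c \<in> C\<close>, is bounded below by
  \<open>- p (- x)\<close> because \<open>p \<ge> d\<close> on \<open>C\<close>, and convexity of \<open>C\<close> makes it subadditive. A linear functional
  below \<open>q\<close> must be at least \<open>d\<close> on \<open>C\<close>, since it is at most \<open>- d\<close> on \<open>- C\<close>.\<close>

lemma sublinear_tilt:
  assumes p: "sublinear p" and C: "convex C" "C \<noteq> {}" and d: "\<And>c. c \<in> C \<Longrightarrow> d \<le> p c"
  obtains q where "sublinear q" "\<And>x. q x \<le> p x" "\<And>c. c \<in> C \<Longrightarrow> q (- c) \<le> - d"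
proof -
  define q where "q x = (INF (t, c)\<in>{0..} \<times> C. p (x + t *\<^sub>R c) - t * d)" for x
  have low: "- p (- x) \<le> p (x + t *\<^sub>R c) - t * d" if "0 \<le> t" "c \<in> C" for x t c
  proof -
    have "t * d \<le> p (t *\<^sub>R c)"
      using that d sublinear_scale[OF p] by (simp add: mult_left_mono)
    also have "\<dots> \<le> p (x + t *\<^sub>R c) + p (- x)"
      using sublinear_add[OF p, of "x + t *\<^sub>R c" "- x"] by simp
    finally show ?thesis by simp
  qed
  have q_le: "q x \<le> p (x + t *\<^sub>R c) - t * d" if "0 \<le> t" "c \<in> C" for x t c
    unfolding q_def
    by (rule cINF_lower2[where x = "(t, c)"]) (use that low in \<open>auto intro!: bdd_belowI2[where m = "- p (- x)"]\<close>)
  have q_ge: "m \<le> q x" if "\<And>t c. 0 \<le> t \<Longrightarrow> c \<in> C \<Longrightarrow> m \<le> p (x + t *\<^sub>R c) - t * d" for x m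
    unfolding q_def using C(2) that by (intro cINF_greatest) auto
  obtain c0 where c0: "c0 \<in> C" using C(2) by auto
  have q_le_p: "q x \<le> p x" for x
    using q_le[of 0 c0 x] c0 by simp
  have "sublinear q"
  proof (rule sublinearI)
    fix x y
    have *: "q (x + y) \<le> (p (x + s *\<^sub>R c) - s * d) + (p (y + t *\<^sub>R c') - t * d)"
      if st: "0 \<le> s" "0 \<le> t" and c: "c \<in> C" "c' \<in> C" for s t c c'
    proof -
      have "\<exists>c''\<in>C. s *\<^sub>R c + t *\<^sub>R c' = (s + t) *\<^sub>R c''"
      proof (cases "s + t = 0")
        case True
        then have "s = 0" "t = 0" using st by auto
        then show ?thesis using c by auto
      next
        case False
        then have "(s / (s + t)) *\<^sub>R c + (t / (s + t)) *\<^sub>R c' \<in> C"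
          using st by (intro convexD[OF C(1) c]) (auto simp: add_divide_distrib[symmetric])
        then show ?thesis using False by (intro bexI) (auto simp: scaleR_add_right)
      qed
      then obtain c'' where c'': "c'' \<in> C" "s *\<^sub>R c + t *\<^sub>R c' = (s + t) *\<^sub>R c''" by auto
      have "q (x + y) \<le> p ((x + y) + (s + t) *\<^sub>R c'') - (s + t) * d"
        using st c'' by (intro q_le) auto
      also have "(x + y) + (s + t) *\<^sub>R c'' = (x + s *\<^sub>R c) + (y + t *\<^sub>R c')"
        unfolding c''(2)[symmetric] by simp
      also have "p \<dots> \<le> p (x + s *\<^sub>R c) + p (y + t *\<^sub>R c')"
        by (rule sublinear_add[OF p])
      finally show ?thesis by (simp add: algebra_simps)
    qed
    have "q (x + y) - q y \<le> q x"
    proof (rule q_ge)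
      fix s :: real and c assume sc: "0 \<le> s" "c \<in> C"
      have "q (x + y) - (p (x + s *\<^sub>R c) - s * d) \<le> q y"
        by (rule q_ge) (use *[OF sc(1) _ sc(2)] in \<open>simp add: algebra_simps\<close>)
      then show "q (x + y) - q y \<le> p (x + s *\<^sub>R c) - s * d" by simp
    qed
    then show "q (x + y) \<le> q x + q y" by simp
  next
    have "- p (- 0) \<le> q 0" by (rule q_ge) (rule low)
    then show "q 0 = 0" using q_le_p[of 0] sublinear_zero[OF p] by simp
  next
    fix t :: real and x assume t: "0 < t"
    have "q (t *\<^sub>R x) / t \<le> q x"
    proof (rule q_ge)
      fix s :: real and c assume sc: "0 \<le> s" "c \<in> C"
      have "q (t *\<^sub>R x) \<le> p (t *\<^sub>R x + (t * s) *\<^sub>R c) - (t * s) * d"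
        using t sc by (intro q_le) auto
      also have "t *\<^sub>R x + (t * s) *\<^sub>R c = t *\<^sub>R (x + s *\<^sub>R c)"
        by (simp add: scaleR_add_right)
      also have "p \<dots> = t * p (x + s *\<^sub>R c)"
        using t by (intro sublinear_scale[OF p]) simp
      finally show "q (t *\<^sub>R x) / t \<le> p (x + s *\<^sub>R c) - s * d"
        using t by (simp add: field_simps)
    qed
    then show "q (t *\<^sub>R x) \<le> t * q x" using t by (simp add: field_simps)
  qed
  moreover have "q (- c) \<le> - d" if "c \<in> C" for c
    using q_le[of 1 c "- c"] that sublinear_zero[OF p] by simp
  ultimately show ?thesis using that q_le_p by blast
qed

text \<open>Tilting \<open>q\<close> along a single vector \<open>y\<close> with \<open>d = q y\<close> gives a sublinear functional below \<open>q\<close>, hence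
  \<open>q\<close> itself. So \<open>q (- y) \<le> - q y\<close>, and this makes \<open>q\<close> additive.\<close>

lemma minimal_sublinear_linear:
  assumes q: "sublinear q" and min: "\<And>r. sublinear r \<Longrightarrow> (\<And>x. r x \<le> q x) \<Longrightarrow> r = q"
  shows "linear q"
proof -
  have add: "q (x + y) = q x + q y" for x y
  proof -
    obtain r where r: "sublinear r" "\<And>x. r x \<le> q x" "\<And>c. c \<in> {y} \<Longrightarrow> r (- c) \<le> - q y"
      by (rule sublinear_tilt[OF q, of "{y}" "q y"]) auto
    have "r = q" using min r by blast
    then have "q (- y) \<le> - q y" using r(3) by auto
    then have "q x \<le> q (x + y) - q y"
      using sublinear_add[OF q, of "x + y" "- y"] by simp
    then show ?thesis using sublinear_add[OF q, of x y] by simp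
  qed
  have neg: "q (- x) = - q x" for x
    using add[of x "- x"] sublinear_zero[OF q] by simp
  show ?thesis
  proof (rule linearI[OF add])
    fix t x
    show "q (t *\<^sub>R x) = t *\<^sub>R q x"
    proof (cases "0 \<le> t")
      case False
      then have "q ((- t) *\<^sub>R x) = (- t) * q x" by (intro sublinear_scale[OF q]) auto
      then show ?thesis using neg[of "t *\<^sub>R x"] by simp
    qed (simp add: sublinear_scale[OF q])
  qed
qed

text \<open>By Zorn's lemma there is a minimal sublinear functional below \<open>p\<close>: the pointwise infimum of a
  chain of sublinear functionals is subadditive because any two members have a common lower bound
  in the chain.\<close>

lemma exists_linear_below_sublinear:
  assumes p: "sublinear p"
  obtains \<phi> where "linear \<phi>" "\<And>x. \<phi> x \<le> p x"
proof -
  define A where "A = {q. sublinear q \<and> (\<forall>x. q x \<le> p x)}"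
  define P where "P q r \<longleftrightarrow> (\<forall>x. r x \<le> q x)" for q r :: "'a \<Rightarrow> real"
  have po: "partial_order_on A (relation_of P A)"
    by (rule partial_order_on_relation_ofI) (auto simp: P_def fun_eq_iff intro: order_trans antisym)
  have "\<exists>m\<in>A. \<forall>a\<in>A. P m a \<longrightarrow> a = m"
  proof (rule predicate_Zorn[OF po])
    fix C assume C: "C \<in> Chains (relation_of P A)"
    show "\<exists>u\<in>A. \<forall>a\<in>C. P a u"
    proof (cases "C = {}")
      case True
      then show ?thesis using p by (auto simp: A_def)
    next
      case False
      have CA: "C \<subseteq> A" and tot: "\<And>q r. q \<in> C \<Longrightarrow> r \<in> C \<Longrightarrow> P q r \<or> P r q"
        using C by (auto simp: Chains_def relation_of_def)
      define u where "u x = (INF q\<in>C. q x)" for x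
      have low: "- p (- x) \<le> q x" if "q \<in> C" for q x
      proof -
        have "sublinear q" "q (- x) \<le> p (- x)" using that CA by (auto simp: A_def)
        with sublinear_minus[of q x] show ?thesis by simp
      qed
      have u_le: "u x \<le> q x" if "q \<in> C" for q x
        unfolding u_def using that low by (intro cINF_lower bdd_belowI2[where m = "- p (- x)"])
      have u_ge: "m \<le> u x" if "\<And>q. q \<in> C \<Longrightarrow> m \<le> q x" for m x
        unfolding u_def using that False by (intro cINF_greatest)
      have sub: "sublinear q" if "q \<in> C" for q using that CA by (auto simp: A_def)
      obtain q0 where q0: "q0 \<in> C" using False by auto
      have "sublinear u"
      proof (rule sublinearI)
        fix x y
        have *: "u (x + y) \<le> q x + r y" if qr: "q \<in> C" "r \<in> C" for q r
        proof -
          have "\<exists>s\<in>C. s x \<le> q x \<and> s y \<le> r y"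
            using tot[OF qr] qr by (auto simp: P_def)
          then obtain s where s: "s \<in> C" "s x \<le> q x" "s y \<le> r y" by auto
          show ?thesis
            using u_le[OF s(1), of "x + y"] sublinear_add[OF sub[OF s(1)], of x y] s by simp
        qed
        have "u (x + y) - u y \<le> u x"
        proof (rule u_ge)
          fix q assume q: "q \<in> C"
          have "u (x + y) - q x \<le> u y"
            by (rule u_ge) (use *[OF q] in \<open>simp add: algebra_simps\<close>)
          then show "u (x + y) - u y \<le> q x" by simp
        qed
        then show "u (x + y) \<le> u x + u y" by simp
      next
        have "0 \<le> u 0" by (rule u_ge) (simp add: sublinear_zero sub)
        moreover have "u 0 \<le> 0" using u_le[OF q0, of 0] sublinear_zero[OF sub[OF q0]] by simp
        ultimately show "u 0 = 0" by simp
      next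
        fix t :: real and x assume t: "0 < t"
        have "u (t *\<^sub>R x) / t \<le> u x"
        proof (rule u_ge)
          fix q assume q: "q \<in> C"
          show "u (t *\<^sub>R x) / t \<le> q x"
            using u_le[OF q, of "t *\<^sub>R x"] sublinear_scale[OF sub[OF q], of t x] t
            by (simp add: field_simps)
        qed
        then show "u (t *\<^sub>R x) \<le> t * u x" using t by (simp add: field_simps)
      qed
      moreover have "u x \<le> p x" for x
        using u_le[OF q0, of x] q0 CA by (auto simp: A_def intro: order_trans)
      ultimately show ?thesis
        using u_le by (intro bexI[of _ u]) (auto simp: A_def P_def)
    qed
  qed
  then obtain m where m: "m \<in> A" and max: "\<And>a. a \<in> A \<Longrightarrow> P m a \<Longrightarrow> a = m" by blast
  have "linear m"
  proof (rule minimal_sublinear_linear)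
    show "sublinear m" using m by (simp add: A_def)
    fix r assume r: "sublinear r" "\<And>x. r x \<le> m x"
    then have "r \<in> A" using m by (auto simp: A_def intro: order_trans)
    then show "r = m" using max r by (auto simp: P_def)
  qed
  with m that show ?thesis by (auto simp: A_def)
qed

text \<open>The Mazur-Orlicz theorem. It is used with the norm as \<open>p\<close>, to separate a convex set from \<open>0\<close>, and
  with the supremum of the real part as \<open>p\<close>, to produce positive functionals.\<close>

theorem mazur_orlicz:
  assumes p: "sublinear p" and C: "convex C" "C \<noteq> {}" and d: "\<And>c. c \<in> C \<Longrightarrow> d \<le> p c"
  shows "\<exists>\<phi>. linear \<phi> \<and> (\<forall>x. \<phi> x \<le> p x) \<and> (\<forall>c\<in>C. d \<le> \<phi> c)"
proof -
  obtain q where q: "sublinear q" "\<And>x. q x \<le> p x" "\<And>c. c \<in> C \<Longrightarrow> q (- c) \<le> - d"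
    using sublinear_tilt[OF p C d] by blast
  obtain \<phi> where \<phi>: "linear \<phi>" "\<And>x. \<phi> x \<le> q x"
    using exists_linear_below_sublinear[OF q(1)] by blast
  have "d \<le> \<phi> c" if "c \<in> C" for c
    using \<phi>(2)[of "- c"] q(3)[OF that] linear_neg[OF \<phi>(1), of c] by simp
  with \<phi> q(2) show ?thesis by (intro exI[of _ \<phi>]) (auto intro: order_trans)
qed

section \<open>The Riesz representation theorem on compact spaces\<close>

text \<open>\<open>L\<close> takes arbitrary functions as arguments, so that the sums and truncations in the construction of
  the measure are plain functions; the assumptions constrain \<open>L\<close> on the continuous ones.\<close>

locale riesz_functional =
  fixes L :: "('k::t2_space \<Rightarrow> real) \<Rightarrow> real"
  assumes compact_UNIV: "compact (UNIV :: 'k set)"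
    and L_add: "continuous_on UNIV f \<Longrightarrow> continuous_on UNIV g \<Longrightarrow> L (\<lambda>x. f x + g x) = L f + L g"
    and L_scale: "continuous_on UNIV f \<Longrightarrow> L (\<lambda>x. c * f x) = c * L f"
    and L_nonneg: "continuous_on UNIV f \<Longrightarrow> (\<And>x. 0 \<le> f x) \<Longrightarrow> 0 \<le> L f"
    and L_one: "L (\<lambda>x. 1) = 1"
begin

lemma L_const: "L (\<lambda>x. c) = c"
  using L_scale[of "\<lambda>x. 1" c] L_one by simp

lemma L_mono:
  assumes "continuous_on UNIV f" "continuous_on UNIV g" "\<And>x. f x \<le> g x"
  shows "L f \<le> L g"
proof -
  have "L (\<lambda>x. f x + (g x - f x)) = L f + L (\<lambda>x. g x - f x)"
    using assms by (intro L_add continuous_intros)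
  moreover have "L (\<lambda>x. g x - f x) \<ge> 0"
    using assms by (intro L_nonneg continuous_intros) auto
  ultimately show ?thesis by simp
qed

lemma L_sum:
  assumes "finite I" "\<And>i. i \<in> I \<Longrightarrow> continuous_on UNIV (g i)"
  shows "L (\<lambda>x. \<Sum>i\<in>I. g i x) = (\<Sum>i\<in>I. L (g i))"
  using assms
proof (induction I rule: finite_induct)
  case empty then show ?case by (simp add: L_const)
next
  case (insert i I)
  then show ?case using L_add[of "g i" "\<lambda>x. \<Sum>i\<in>I. g i x"]
    by (auto intro!: continuous_intros)
qed

definition below_indicator :: "'k set \<Rightarrow> ('k \<Rightarrow> real) set" where
  "below_indicator U = {f. continuous_on UNIV f \<and> (\<forall>x. 0 \<le> f x \<and> f x \<le> 1) \<and> (\<forall>x. x \<notin> U \<longrightarrow> f x = 0)}"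

text \<open>\<open>L\<close> extended to the indicator functions of open sets by approximation from below.\<close>

definition open_content :: "'k set \<Rightarrow> ennreal" where
  "open_content U = (SUP f\<in>below_indicator U. ennreal (L f))"

definition outer :: "'k set \<Rightarrow> ennreal" where
  "outer E = (INF U\<in>{U. open U \<and> E \<subseteq> U}. open_content U)"

lemma zero_below: "(\<lambda>x. 0) \<in> below_indicator U"
  by (simp add: below_indicator_def)

lemma below_ne: "below_indicator U \<noteq> {}"
  using zero_below by blast

lemma below_cont: "f \<in> below_indicator U \<Longrightarrow> continuous_on UNIV f"
  by (simp add: below_indicator_def)

lemma below_nonneg: "f \<in> below_indicator U \<Longrightarrow> 0 \<le> L f"
  by (intro L_nonneg) (auto simp: below_indicator_def)

lemma le_open_content: "f \<in> below_indicator U \<Longrightarrow> ennreal (L f) \<le> open_content U"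
  unfolding open_content_def by (rule SUP_upper)

lemma open_content_mono: "U \<subseteq> V \<Longrightarrow> open_content U \<le> open_content V"
  unfolding open_content_def by (rule SUP_subset_mono) (auto simp: below_indicator_def)

lemma outer_open: "open U \<Longrightarrow> outer U = open_content U"
  unfolding outer_def by (intro antisym INF_lower INF_greatest) (auto intro: open_content_mono)

lemma outer_mono: "A \<subseteq> B \<Longrightarrow> outer A \<le> outer B"
  unfolding outer_def by (rule INF_superset_mono) auto

lemma outer_UNIV: "outer UNIV = 1"
proof -
  have "open_content UNIV = 1"
  proof (rule antisym)
    show "open_content UNIV \<le> 1"
      unfolding open_content_def
    proof (rule SUP_least)
      fix f assume f: "f \<in> below_indicator UNIV"
      have "L f \<le> L (\<lambda>x. 1)"
        using f by (intro L_mono) (auto simp: below_indicator_def)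
      then show "ennreal (L f) \<le> 1"
        by (simp add: L_one)
    qed
    show "1 \<le> open_content UNIV"
      using le_open_content[of "\<lambda>x. 1" UNIV] by (simp add: L_one below_indicator_def)
  qed
  then show ?thesis by (simp add: outer_open)
qed

text \<open>A compact Hausdorff space is normal, and Urysohn's lemma separates \<open>x\<close> from the complement of \<open>U\<close>.\<close>

lemma urysohn_bump:
  assumes "open U" "x \<in> U"
  obtains u where "u \<in> below_indicator U" "u x = 1"
proof -
  have "compact_space (euclidean :: 'k topology)"
    using compact_UNIV by (simp add: compact_space_def)
  moreover have "Hausdorff_space (euclidean :: 'k topology)"
    unfolding Hausdorff_space_def disjnt_def using hausdorff by auto
  ultimately have "normal_space (euclidean :: 'k topology)"
    by (simp add: compact_Hausdorff_or_regular_imp_normal_space)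
  then obtain f where f: "continuous_map euclidean (top_of_set {0..1::real}) f" "f ` (- U) \<subseteq> {0}" "f ` {x} \<subseteq> {1}"
    by (rule Urysohn_lemma[of _ "- U" "{x}" 0 1]) (use assms in \<open>auto simp: disjnt_def\<close>)
  then have "f \<in> below_indicator U"
    by (auto simp: below_indicator_def continuous_map_in_subtopology image_subset_iff)
  with f that show ?thesis by auto
qed

text \<open>If \<open>f\<close> lies below the indicator of the union, the compact set \<open>{f \<ge> e}\<close> is covered by finitely many
  bumps that are almost \<open>1\<close>. Adding the bumps that belong to the same \<open>U i\<close> and truncating at \<open>1\<close>
  gives functions below the indicators of the \<open>U i\<close> whose sum dominates \<open>f - e\<close>.\<close>

lemma open_content_subadditive:
  fixes U :: "nat \<Rightarrow> 'k set"
  assumes op: "\<And>i. open (U i)"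
  shows "open_content (\<Union>i. U i) \<le> (\<Sum>i. open_content (U i))"
  unfolding open_content_def[of "\<Union>i. U i"]
proof (rule SUP_least, rule ennreal_le_epsilon)
  fix f and e :: real
  assume f: "f \<in> below_indicator (\<Union>i. U i)" and e: "0 < e"
  define K where "K = {x. e \<le> f x}"
  have "closed K"
    unfolding K_def using below_cont[OF f] by (intro closed_Collect_le continuous_intros) auto
  then have K: "compact K"
    using compact_UNIV closed_Int_compact by fastforce
  have "\<exists>i u. u \<in> below_indicator (U i) \<and> u x = 1" if "x \<in> K" for x
  proof -
    have "f x \<noteq> 0" using that e by (auto simp: K_def)
    then obtain i where "x \<in> U i"
      using f by (auto simp: below_indicator_def)
    then show ?thesis using urysohn_bump[OF op, of x i] by metis
  qed
  then obtain i u where iu: "\<And>x. x \<in> K \<Longrightarrow> u x \<in> below_indicator (U (i x)) \<and> u x x = 1"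
    by metis
  define W where "W x = {y. u x y > 1 - e}" for x
  have "open (W x)" if "x \<in> K" for x
    unfolding W_def using iu[OF that] by (intro open_Collect_less continuous_intros below_cont) auto
  moreover have "K \<subseteq> (\<Union>x\<in>K. W x)"
    using iu e by (auto simp: W_def intro!: bexI)
  ultimately obtain D where D: "D \<subseteq> K" "finite D" "K \<subseteq> (\<Union>x\<in>D. W x)"
    using compactE_image[OF K, of K W] by metis
  define g where "g j y = min 1 (\<Sum>x\<in>{x\<in>D. i x = j}. u x y)" for j y
  have g: "g j \<in> below_indicator (U j)" for j
  proof -
    have "0 \<le> (\<Sum>x\<in>{x\<in>D. i x = j}. u x y)" for y
      using iu D(1) by (intro sum_nonneg) (auto simp: below_indicator_def)
    moreover have "(\<Sum>x\<in>{x\<in>D. i x = j}. u x y) = 0" if "y \<notin> U j" for y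
      using iu D(1) that by (intro sum.neutral) (auto simp: below_indicator_def)
    moreover have "continuous_on UNIV (g j)"
      unfolding g_def using iu D(1) by (intro continuous_intros below_cont) auto
    ultimately show ?thesis by (auto simp: below_indicator_def g_def)
  qed
  define I where "I = i ` D"
  have I: "finite I" using D by (simp add: I_def)
  have le: "f y \<le> (\<Sum>j\<in>I. g j y) + e" for y
  proof (cases "y \<in> K")
    case False
    have "0 \<le> (\<Sum>j\<in>I. g j y)"
      using g by (intro sum_nonneg) (auto simp: below_indicator_def)
    with False show ?thesis by (simp add: K_def)
  next
    case True
    then obtain x where x: "x \<in> D" "1 - e < u x y"
      using D by (auto simp: W_def)
    have "u x y \<le> (\<Sum>z\<in>{z\<in>D. i z = i x}. u z y)"
      using iu D x by (intro member_le_sum) (auto simp: below_indicator_def)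
    moreover have "f y \<le> 1" using f by (auto simp: below_indicator_def)
    ultimately have "f y - e \<le> g (i x) y"
      using x e by (auto simp: g_def)
    also have "\<dots> \<le> (\<Sum>j\<in>I. g j y)"
      using g I x by (intro member_le_sum) (auto simp: below_indicator_def I_def)
    finally show ?thesis by simp
  qed
  have "L f \<le> L (\<lambda>y. (\<Sum>j\<in>I. g j y) + e)"
    using below_cont[OF f] below_cont[OF g] le by (intro L_mono continuous_intros) auto
  also have "\<dots> = (\<Sum>j\<in>I. L (g j)) + e"
    using below_cont[OF g] I by (subst L_add) (auto intro!: continuous_intros simp: L_const L_sum)
  finally have "ennreal (L f) \<le> ennreal ((\<Sum>j\<in>I. L (g j)) + e)"
    by (rule ennreal_leI)
  also have "\<dots> = (\<Sum>j\<in>I. ennreal (L (g j))) + ennreal e"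
    using below_nonneg[OF g] e by (simp add: sum_nonneg sum_ennreal)
  also have "(\<Sum>j\<in>I. ennreal (L (g j))) \<le> (\<Sum>j\<in>I. open_content (U j))"
    by (intro sum_mono le_open_content g)
  also have "\<dots> \<le> (\<Sum>j. open_content (U j))"
    by (rule sum_le_suminf) (use I in auto)
  finally show "ennreal (L f) \<le> (\<Sum>j. open_content (U j)) + ennreal e"
    by (simp add: add_right_mono)
qed

lemma outer_approx:
  assumes "0 < e"
  obtains U where "open U" "E \<subseteq> U" "outer U \<le> outer E + ennreal e"
proof -
  have fin: "outer E \<noteq> \<infinity>"
    using outer_mono[of E UNIV] by (auto simp: outer_UNIV top_unique)
  then have "outer E < outer E + ennreal e"
    using assms by (auto simp: ennreal_zero_less_top less_top)
  then obtain U where "open U" "E \<subseteq> U" "open_content U < outer E + ennreal e"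
    unfolding outer_def[of E] INF_less_iff by auto
  then show ?thesis by (intro that[of U]) (auto simp: outer_open)
qed

lemma outer_empty: "outer {} = 0"
proof -
  have "open_content {} \<le> 0"
    unfolding open_content_def
  proof (rule SUP_least)
    fix f assume "f \<in> below_indicator {}"
    then have "f = (\<lambda>x. 0)" by (auto simp: below_indicator_def)
    then show "ennreal (L f) \<le> 0" by (simp add: L_const)
  qed
  then show ?thesis by (simp add: outer_open)
qed

lemma outer_measure: "outer_measure_space (Pow UNIV) outer"
  unfolding outer_measure_space_def
proof (intro conjI)
  show "positive (Pow UNIV) outer" by (simp add: positive_def outer_empty)
  show "increasing (Pow UNIV) outer" by (simp add: increasing_def outer_mono)
  show "countably_subadditive (Pow UNIV) outer"
    unfolding countably_subadditive_def
  proof (intro allI impI)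
    fix A :: "nat \<Rightarrow> 'k set"
    show "outer (\<Union>i. A i) \<le> (\<Sum>i. outer (A i))"
    proof (rule ennreal_le_epsilon)
      fix e :: real assume e: "0 < e"
      have "\<exists>U. open U \<and> A i \<subseteq> U \<and> outer U \<le> outer (A i) + ennreal (e * (1/2) ^ Suc i)" for i
        using outer_approx[of "e * (1/2) ^ Suc i" "A i"] e
        by (metis half_gt_zero_iff mult_pos_pos zero_less_one zero_less_power)
      then obtain U where U: "\<And>i. open (U i)" "\<And>i. A i \<subseteq> U i"
          "\<And>i. outer (U i) \<le> outer (A i) + ennreal (e * (1/2) ^ Suc i)"
        by metis
      have split: "ennreal (e * (1/2) ^ Suc i) = ennreal e * ennreal ((1/2) ^ Suc i)" for i
        using e by (intro ennreal_mult) auto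
      have "outer (\<Union>i. A i) \<le> outer (\<Union>i. U i)"
        using U(2) by (intro outer_mono) blast
      also have "\<dots> = open_content (\<Union>i. U i)"
        using U(1) by (intro outer_open) auto
      also have "\<dots> \<le> (\<Sum>i. open_content (U i))"
        by (rule open_content_subadditive[OF U(1)])
      also have "\<dots> \<le> (\<Sum>i. outer (A i) + ennreal (e * (1/2) ^ Suc i))"
        using U(1,3) by (intro suminf_le) (auto simp: outer_open)
      also have "\<dots> = (\<Sum>i. outer (A i)) + (\<Sum>i. ennreal e * ennreal ((1/2) ^ Suc i))"
        unfolding split by (intro suminf_add[symmetric]) auto
      also have "(\<Sum>i. ennreal e * ennreal ((1/2) ^ Suc i)) = ennreal e"
        unfolding ennreal_suminf_cmult by (subst suminf_ennreal_eq[OF zero_le_power power_half_series]) auto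
      finally show "outer (\<Union>i. A i) \<le> (\<Sum>i. outer (A i)) + ennreal e" .
    qed
  qed
qed

lemma outer_Un: "outer (A \<union> B) \<le> outer A + outer B"
proof -
  interpret sigma_algebra "UNIV :: 'k set" "Pow UNIV" by (rule sigma_algebra_Pow)
  have "subadditive (Pow UNIV) outer"
    using outer_measure by (intro countably_subadditive_subadditive) (auto simp: outer_measure_space_def)
  then have "outer (A \<union> (B - A)) \<le> outer A + outer (B - A)"
    unfolding subadditive_def by blast
  also have "\<dots> \<le> outer A + outer B"
    by (intro add_left_mono outer_mono) auto
  finally show ?thesis by simp
qed

text \<open>Choose \<open>f\<close> below the indicator of \<open>U \<inter> V\<close> and then \<open>g\<close> below the indicator of \<open>V - {f \<ge> e}\<close>, an open
  set that contains \<open>V - U\<close>. The functions \<open>(f - e)\<^sup>+\<close> and \<open>g\<close> are nowhere positive simultaneously, so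
  their sum lies below the indicator of \<open>V\<close>.\<close>

lemma open_content_superadditive:
  assumes U: "open U" and V: "open V"
  shows "outer (U \<inter> V) + outer (V - U) \<le> open_content V"
proof -
  have *: "ennreal (L f) + outer (V - U) \<le> open_content V" if f: "f \<in> below_indicator (U \<inter> V)" for f
  proof (rule ennreal_le_epsilon)
    fix e :: real assume e: "0 < e"
    define f' where "f' x = max 0 (f x - e)" for x
    define C where "C = {x. e \<le> f x}"
    have cf: "continuous_on UNIV f'"
      unfolding f'_def using below_cont[OF f] by (intro continuous_intros)
    have "closed C"
      unfolding C_def using below_cont[OF f] by (intro closed_Collect_le continuous_intros) auto
    then have VC: "open (V - C)" using V by auto
    have C: "C \<subseteq> U" using f e by (force simp: C_def below_indicator_def)
    have f'0: "0 \<le> L f'" by (rule L_nonneg[OF cf]) (simp add: f'_def)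
    have "L f \<le> L (\<lambda>x. f' x + e)"
      using below_cont[OF f] cf by (intro L_mono continuous_intros) (auto simp: f'_def)
    also have "\<dots> = L f' + e"
      using cf by (subst L_add) (auto simp: L_const)
    finally have Lf: "ennreal (L f) \<le> ennreal (L f') + ennreal e"
      using f'0 e by (metis ennreal_leI ennreal_plus less_imp_le)
    have "ennreal (L g) + ennreal (L f') \<le> open_content V" if g: "g \<in> below_indicator (V - C)" for g
    proof -
      have "(\<lambda>x. g x + f' x) \<in> below_indicator V"
        unfolding below_indicator_def mem_Collect_eq
      proof (intro conjI allI impI)
        show "continuous_on UNIV (\<lambda>x. g x + f' x)"
          using cf below_cont[OF g] by (intro continuous_intros)
        fix x
        show "0 \<le> g x + f' x" using g by (auto simp: below_indicator_def f'_def)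
        have "f x \<le> 1" "g x \<le> 1" using f g by (auto simp: below_indicator_def)
        moreover have "g x = 0" if "x \<in> C" using g that by (auto simp: below_indicator_def)
        moreover have "f' x = 0" if "x \<notin> C" using that by (auto simp: f'_def C_def)
        ultimately show "g x + f' x \<le> 1"
          using e by (cases "x \<in> C") (auto simp: f'_def)
        show "g x + f' x = 0" if "x \<notin> V"
        proof -
          have "f x = 0" "g x = 0" using f g that by (auto simp: below_indicator_def)
          then show ?thesis using e by (simp add: f'_def)
        qed
      qed
      from le_open_content[OF this] show ?thesis
        using f'0 below_nonneg[OF g] cf below_cont[OF g] by (simp add: L_add)
    qed
    then have "(SUP g\<in>below_indicator (V - C). ennreal (L g) + ennreal (L f')) \<le> open_content V"
      by (rule SUP_least)
    then have "open_content (V - C) + ennreal (L f') \<le> open_content V"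
      unfolding open_content_def[of "V - C"] by (simp add: ennreal_SUP_add_left below_ne)
    moreover have "outer (V - U) \<le> open_content (V - C)"
      using C VC outer_mono[of "V - U" "V - C"] by (auto simp: outer_open)
    ultimately have "outer (V - U) + ennreal (L f') \<le> open_content V"
      by (meson add_right_mono order_trans)
    then have "outer (V - U) + ennreal (L f') + ennreal e \<le> open_content V + ennreal e"
      by (rule add_right_mono)
    moreover have "ennreal (L f) + outer (V - U) \<le> outer (V - U) + ennreal (L f') + ennreal e"
      using add_left_mono[OF Lf, of "outer (V - U)"] by (simp add: ac_simps)
    ultimately show "ennreal (L f) + outer (V - U) \<le> open_content V + ennreal e"
      by (rule order_trans[rotated])
  qed
  have "outer (U \<inter> V) + outer (V - U) = (SUP f\<in>below_indicator (U \<inter> V). ennreal (L f) + outer (V - U))"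
    using U V by (simp add: outer_open open_Int open_content_def ennreal_SUP_add_left below_ne)
  also have "\<dots> \<le> open_content V"
    by (intro SUP_least *)
  finally show ?thesis .
qed

text \<open>The Caratheodory criterion for open sets: testing it on open sets suffices, since the outer
  measure of any set is approximated by that of open supersets.\<close>

lemma open_in_lambda_system:
  assumes U: "open U"
  shows "U \<in> lambda_system UNIV (Pow UNIV) outer"
  unfolding lambda_system_def
proof (intro CollectI conjI ballI)
  fix E :: "'k set"
  show "outer (U \<inter> E) + outer ((UNIV - U) \<inter> E) = outer E"
  proof (rule antisym)
    show "outer (U \<inter> E) + outer ((UNIV - U) \<inter> E) \<le> outer E"
      unfolding outer_def[of E]
    proof (rule INF_greatest)
      fix V assume "V \<in> {V. open V \<and> E \<subseteq> V}"
      then have V: "open V" "E \<subseteq> V" by auto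
      have "outer (U \<inter> E) + outer ((UNIV - U) \<inter> E) \<le> outer (U \<inter> V) + outer (V - U)"
        using V by (intro add_mono outer_mono) auto
      also have "\<dots> \<le> open_content V"
        by (rule open_content_superadditive[OF U V(1)])
      finally show "outer (U \<inter> E) + outer ((UNIV - U) \<inter> E) \<le> open_content V" .
    qed
    have "outer ((U \<inter> E) \<union> ((UNIV - U) \<inter> E)) \<le> outer (U \<inter> E) + outer ((UNIV - U) \<inter> E)"
      by (rule outer_Un)
    moreover have "(U \<inter> E) \<union> ((UNIV - U) \<inter> E) = E" by auto
    ultimately show "outer E \<le> outer (U \<inter> E) + outer ((UNIV - U) \<inter> E)" by simp
  qed
qed simp

definition representing_measure :: "'k measure" where
  "representing_measure = measure_of UNIV (sets borel) outer"

lemma sets_representing_measure: "sets representing_measure = sets borel"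
  unfolding representing_measure_def using sets.sets_measure_of_eq[of borel] by simp

lemma space_representing_measure [simp]: "space representing_measure = UNIV"
  unfolding representing_measure_def by (simp add: space_measure_of_conv)

lemma emeasure_representing_measure:
  assumes "A \<in> sets borel"
  shows "emeasure representing_measure A = outer A"
proof -
  interpret sigma_algebra "UNIV :: 'k set" "Pow UNIV" by (rule sigma_algebra_Pow)
  have ls: "measure_space UNIV (lambda_system UNIV (Pow UNIV) outer) outer"
    by (rule caratheodory_lemma[OF outer_measure])
  then have "sigma_algebra UNIV (lambda_system UNIV (Pow UNIV) outer)"
    by (simp add: measure_space_def)
  then have "sigma_sets UNIV {S::'k set. open S} \<subseteq> lambda_system UNIV (Pow UNIV) outer"
    by (rule sigma_algebra.sigma_sets_subset) (use open_in_lambda_system in blast)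
  then have "measure_space UNIV (sets borel) outer"
    using sets.sigma_algebra_axioms[of borel]
    by (intro measure_down[OF ls]) (auto simp: sets_borel)
  then show ?thesis
    unfolding representing_measure_def
    using assms sets.sigma_algebra_axioms[of borel]
    by (intro emeasure_measure_of_sigma) (auto simp: measure_space_def)
qed

lemma prob_representing_measure: "prob_space representing_measure"
  by (rule prob_spaceI) (simp add: emeasure_representing_measure outer_UNIV)

text \<open>Outer regularity is built into the definition of the outer measure. Inner regularity follows by
  passing to complements, as the measure is finite and closed sets are compact.\<close>

lemma regular_representing_measure: "regular_borel_measure representing_measure"
  unfolding regular_borel_measure_def
proof (intro conjI ballI)
  interpret prob_space representing_measure by (rule prob_representing_measure)
  show "sets representing_measure = sets borel" by (rule sets_representing_measure)
  fix B :: "'k set" assume B: "B \<in> sets borel"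
  show "emeasure representing_measure B = (INF U\<in>{U. open U \<and> B \<subseteq> U}. emeasure representing_measure U)"
    using B by (simp add: emeasure_representing_measure outer_def[of B] outer_open)
  show "emeasure representing_measure B = (SUP C\<in>{C. compact C \<and> C \<in> sets borel \<and> C \<subseteq> B}. emeasure representing_measure C)"
  proof (rule antisym)
    show "emeasure representing_measure B \<le> (SUP C\<in>{C. compact C \<and> C \<in> sets borel \<and> C \<subseteq> B}. emeasure representing_measure C)"
    proof (rule ennreal_le_epsilon)
      fix e :: real assume e: "0 < e"
      obtain U where U: "open U" "- B \<subseteq> U" "outer U \<le> outer (- B) + ennreal e"
        using outer_approx[OF e] .
      have bs: "U \<in> sets representing_measure" "B \<in> sets representing_measure" "- U \<in> sets representing_measure" "- B \<in> sets representing_measure"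
        using U B by (auto simp: sets_representing_measure)
      have "emeasure representing_measure U \<le> emeasure representing_measure (- B) + ennreal e"
        using U(3) bs by (simp add: emeasure_representing_measure sets_representing_measure)
      then have "ennreal (measure representing_measure U) \<le> ennreal (measure representing_measure (- B) + e)"
        using e by (simp add: emeasure_eq_measure)
      then have "measure representing_measure U \<le> measure representing_measure (- B) + e"
        using e by (subst (asm) ennreal_le_iff) auto
      moreover have "measure representing_measure (- B) = 1 - measure representing_measure B" "measure representing_measure (- U) = 1 - measure representing_measure U"
        using prob_compl[OF bs(2)] prob_compl[OF bs(1)] by (auto simp: Compl_eq_Diff_UNIV)
      ultimately have "measure representing_measure B \<le> measure representing_measure (- U) + e" by simp
      then have "ennreal (measure representing_measure B) \<le> ennreal (measure representing_measure (- U) + e)"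
        by (rule ennreal_leI)
      then have "emeasure representing_measure B \<le> emeasure representing_measure (- U) + ennreal e"
        using e by (simp add: emeasure_eq_measure)
      also have "emeasure representing_measure (- U) \<le> (SUP C\<in>{C. compact C \<and> C \<in> sets borel \<and> C \<subseteq> B}. emeasure representing_measure C)"
        using U(1,2) compact_UNIV closed_Int_compact[of "- U" UNIV] by (intro SUP_upper) auto
      finally show "emeasure representing_measure B \<le> (SUP C\<in>{C. compact C \<and> C \<in> sets borel \<and> C \<subseteq> B}. emeasure representing_measure C) + ennreal e"
        by (simp add: add_right_mono)
    qed
    show "(SUP C\<in>{C. compact C \<and> C \<in> sets borel \<and> C \<subseteq> B}. emeasure representing_measure C) \<le> emeasure representing_measure B"
      using B by (intro SUP_least emeasure_mono) (auto simp: sets_representing_measure)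
  qed
qed

lemma integrable_representing_measure:
  assumes "continuous_on UNIV (f :: 'k \<Rightarrow> 'b::{banach, second_countable_topology})"
  shows "integrable representing_measure f"
proof -
  interpret prob_space representing_measure by (rule prob_representing_measure)
  have "compact (range f)" using compact_continuous_image[OF assms compact_UNIV] .
  then obtain b where "\<And>x. norm (f x) \<le> b"
    using compact_imp_bounded[of "range f"] unfolding bounded_iff by auto
  moreover have "f \<in> borel_measurable representing_measure"
    using borel_measurable_continuous_onI[OF assms] measurable_cong_sets[OF sets_representing_measure refl] by blast
  ultimately show ?thesis
    by (intro integrable_const_bound[where B = b] AE_I2)
qed

lemma sum_clamp:
  fixes t :: real
  assumes "0 \<le> t"
  shows "(\<Sum>k<n. max 0 (min 1 (t - real k))) = min t (real n)"
proof (induction n)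
  case (Suc n)
  then show ?case using assms by (simp add: max_def min_def)
qed (use assms in simp)

text \<open>Cut \<open>n f\<close> into \<open>n\<close> layers of height \<open>1\<close>. The \<open>k\<close>-th layer lies below the indicator of
  \<open>{n f > k}\<close> and above that of \<open>{n f > k + 1}\<close>; so its \<open>L\<close>-value is at most the measure of the former
  set, its integral is at least the measure of the latter, and the shift by one index costs at most \<open>1\<close>
  in the sum over all layers.\<close>

lemma L_le_integral_aux:
  assumes f: "continuous_on UNIV f" "\<And>x. 0 \<le> f x \<and> f x \<le> 1" and n: "0 < n"
  shows "L f \<le> (LINT x|representing_measure. f x) + 1 / real n"
proof -
  interpret prob_space representing_measure by (rule prob_representing_measure)
  define g where "g k x = max 0 (min 1 (real n * f x - real k))" for k x
  define a where "a k = measure representing_measure {x. real k < real n * f x}" for k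
  have cg: "continuous_on UNIV (g k)" for k
    unfolding g_def using f by (intro continuous_intros)
  have sum_g: "(\<Sum>k<n. g k x) = real n * f x" for x
    using sum_clamp[of "real n * f x" n] f(2)[of x] n by (simp add: g_def min_def mult_le_cancel_left1)
  have op: "open {x. real k < real n * f x}" for k
    using f by (intro open_Collect_less continuous_intros)
  have up: "L (g k) \<le> a k" for k
  proof -
    have "g k \<in> below_indicator {x. real k < real n * f x}"
      using cg by (auto simp: below_indicator_def g_def)
    from le_open_content[OF this] have "ennreal (L (g k)) \<le> emeasure representing_measure {x. real k < real n * f x}"
      using op by (simp add: emeasure_representing_measure outer_open)
    then show ?thesis by (simp add: emeasure_eq_measure a_def)
  qed
  have low: "a (Suc k) \<le> (LINT x|representing_measure. g k x)" for k
  proof -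
    have "a (Suc k) = (LINT x|representing_measure. indicator {x. real (Suc k) < real n * f x} x)"
      using op by (simp add: a_def sets_representing_measure)
    also have "\<dots> \<le> (LINT x|representing_measure. g k x)"
    proof (rule integral_mono)
      show "integrable representing_measure (indicator {x. real (Suc k) < real n * f x} :: 'k \<Rightarrow> real)"
        using op[of "Suc k"] by (intro integrable_real_indicator) (auto simp: sets_representing_measure less_top[symmetric])
      show "integrable representing_measure (g k)" by (rule integrable_representing_measure[OF cg])
    qed (auto simp: g_def indicator_def)
    finally show ?thesis .
  qed
  have "real n * L f = L (\<lambda>x. \<Sum>k<n. g k x)"
    using f by (simp add: sum_g L_scale)
  also have "\<dots> = (\<Sum>k<n. L (g k))"
    using cg by (simp add: L_sum)
  also have "\<dots> \<le> (\<Sum>k<n. a k)"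
    by (intro sum_mono up)
  also have "\<dots> \<le> (\<Sum>k<Suc n. a k)"
    by (simp add: a_def)
  also have "\<dots> = a 0 + (\<Sum>k<n. a (Suc k))"
    by (rule sum.lessThan_Suc_shift)
  also have "\<dots> \<le> 1 + (\<Sum>k<n. LINT x|representing_measure. g k x)"
    by (intro add_mono sum_mono low) (simp add: a_def)
  also have "(\<Sum>k<n. LINT x|representing_measure. g k x) = (LINT x|representing_measure. (\<Sum>k<n. g k x))"
    using cg by (intro Bochner_Integration.integral_sum[symmetric] integrable_representing_measure)
  also have "\<dots> = real n * (LINT x|representing_measure. f x)"
    by (simp add: sum_g)
  finally have "L f \<le> (1 + real n * (LINT x|representing_measure. f x)) / real n"
    using n by (simp only: pos_le_divide_eq of_nat_0_less_iff mult.commute)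
  also have "\<dots> = (LINT x|representing_measure. f x) + 1 / real n"
    using n by (simp add: add_divide_distrib)
  finally show ?thesis .
qed

lemma L_le_integral:
  assumes f: "continuous_on UNIV f" "\<And>x. 0 \<le> f x \<and> f x \<le> 1"
  shows "L f \<le> (LINT x|representing_measure. f x)"
proof (rule field_le_epsilon)
  fix e :: real assume "0 < e"
  then obtain n where n: "n > 0" "1 / real n < e"
    by (metis nat_approx_posE of_nat_Suc zero_less_Suc)
  then show "L f \<le> (LINT x|representing_measure. f x) + e"
    using L_le_integral_aux[OF f n(1)] by linarith
qed

text \<open>Both sides are linear and normalised, so \<open>f\<close> may be rescaled to take values in \<open>[0, 1]\<close>, and the
  inequality for \<open>1 - f\<close> gives the reverse of that for \<open>f\<close>.\<close>

lemma L_eq_integral: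
  assumes f: "continuous_on UNIV f"
  shows "L f = (LINT x|representing_measure. f x)"
proof -
  interpret prob_space representing_measure by (rule prob_representing_measure)
  have "compact (range f)" using compact_continuous_image[OF f compact_UNIV] .
  then obtain b where b: "0 < b" "\<And>x. \<bar>f x\<bar> \<le> b"
    using compact_imp_bounded[of "range f"] unfolding bounded_pos by auto
  define g where "g x = 1 / 2 + 1 / (2 * b) * f x" for x
  have "\<bar>f x / b\<bar> \<le> 1" for x using b by (simp add: abs_divide)
  then have g01: "0 \<le> g x" "g x \<le> 1" for x
    using b(1) abs_le_D1[of "f x / b" 1] abs_le_D2[of "f x / b" 1] by (auto simp: g_def field_simps)
  have cg: "continuous_on UNIV g" unfolding g_def using f by (intro continuous_intros)
  have "L g \<le> (LINT x|representing_measure. g x)"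
    using g01 cg by (intro L_le_integral) auto
  moreover have "L (\<lambda>x. 1 + (-1) * g x) \<le> (LINT x|representing_measure. 1 + (-1) * g x)"
    using g01 cg by (intro L_le_integral continuous_intros) auto
  then have "1 - L g \<le> 1 - (LINT x|representing_measure. g x)"
    using cg integrable_representing_measure[OF cg] L_scale[OF cg, of "-1"]
      L_add[of "\<lambda>x. 1" "\<lambda>x. (-1) * g x"]
    by (simp add: L_one continuous_on_minus prob_space[unfolded space_representing_measure])
  ultimately have "L g = (LINT x|representing_measure. g x)" by simp
  moreover have "L g = 1 / 2 + 1 / (2 * b) * L f"
    unfolding g_def using f by (subst L_add) (auto intro!: continuous_intros simp: L_const L_scale simp del: times_divide_eq_left)
  moreover have "(LINT x|representing_measure. g x) = 1 / 2 + 1 / (2 * b) * (LINT x|representing_measure. f x)"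
    unfolding g_def using integrable_representing_measure[OF f] by (simp add: prob_space[unfolded space_representing_measure])
  ultimately show ?thesis using b(1) by simp
qed

end

section \<open>Convex combinations of operators and ergodic nets\<close>

text \<open>Convex combinations in \<^const>\<open>operator_co\<close> are indexed by the operators themselves. For an arbitrary
  index family the weights of equal operators have to be added up.\<close>

lemma operator_co_indexed:
  assumes I: "finite I" and T: "\<And>i. i \<in> I \<Longrightarrow> T i \<in> S"
    and c: "\<And>i. i \<in> I \<Longrightarrow> 0 \<le> c i" "sum c I = 1"
  shows "(\<lambda>y. \<Sum>i\<in>I. c i *\<^sub>R T i y) \<in> operator_co S"
proof -
  define d where "d U = sum c {i\<in>I. T i = U}" for U
  have "(\<Sum>i\<in>I. c i *\<^sub>R T i y) = (\<Sum>U\<in>T ` I. d U *\<^sub>R U y)" for y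
  proof -
    have "(\<Sum>i\<in>I. c i *\<^sub>R T i y) = (\<Sum>U\<in>T ` I. \<Sum>i\<in>{i\<in>I. T i = U}. c i *\<^sub>R T i y)"
      by (rule sum.image_gen[OF I])
    also have "\<dots> = (\<Sum>U\<in>T ` I. d U *\<^sub>R U y)"
      by (intro sum.cong) (auto simp: d_def scaleR_sum_left)
    finally show ?thesis .
  qed
  moreover have "sum d (T ` I) = 1"
    unfolding d_def using sum.image_gen[OF I, of c T] c(2) by simp
  moreover have "0 \<le> d U" for U
    unfolding d_def using c(1) by (intro sum_nonneg) auto
  moreover have "finite (T ` I)" "T ` I \<subseteq> S"
    using I T by auto
  ultimately have "(\<lambda>y. \<Sum>i\<in>I. c i *\<^sub>R T i y) = (\<lambda>y. \<Sum>U\<in>T ` I. d U *\<^sub>R U y) \<and>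
      finite (T ` I) \<and> T ` I \<subseteq> S \<and> (\<forall>U\<in>T ` I. 0 \<le> d U) \<and> sum d (T ` I) = 1"
    by presburger
  then show ?thesis
    unfolding operator_co_def by blast
qed

lemma operator_coE:
  assumes "A \<in> operator_co S"
  obtains F c where "finite F" "F \<subseteq> S" "\<And>T. T \<in> F \<Longrightarrow> 0 \<le> c T" "sum c F = 1"
    "\<And>y. A y = (\<Sum>T\<in>F. c T *\<^sub>R T y)"
  using assms unfolding operator_co_def by blast

lemma operator_co_base: "T \<in> S \<Longrightarrow> T \<in> operator_co S"
  using operator_co_indexed[of "{T}" "\<lambda>T. T" S "\<lambda>_. 1"] by simp

lemma operator_co_comp:
  assumes "A \<in> operator_co S" "B \<in> operator_co S"
    and lin: "\<And>T. T \<in> S \<Longrightarrow> linear T" and comp: "\<And>T U. T \<in> S \<Longrightarrow> U \<in> S \<Longrightarrow> (\<lambda>y. T (U y)) \<in> S"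
  shows "(\<lambda>y. A (B y)) \<in> operator_co S"
proof -
  obtain F c where A: "finite F" "F \<subseteq> S" "\<And>T. T \<in> F \<Longrightarrow> 0 \<le> c T" "sum c F = 1"
      "\<And>y. A y = (\<Sum>T\<in>F. c T *\<^sub>R T y)"
    by (rule operator_coE[OF assms(1)]) blast
  obtain G d where B: "finite G" "G \<subseteq> S" "\<And>T. T \<in> G \<Longrightarrow> 0 \<le> d T" "sum d G = 1"
      "\<And>y. B y = (\<Sum>T\<in>G. d T *\<^sub>R T y)"
    by (rule operator_coE[OF assms(2)]) blast
  have "A (B y) = (\<Sum>(T, U)\<in>F \<times> G. (c T * d U) *\<^sub>R T (U y))" for y
  proof -
    have "A (B y) = (\<Sum>T\<in>F. \<Sum>U\<in>G. (c T * d U) *\<^sub>R T (U y))"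
      unfolding A(5) B(5)
    proof (intro sum.cong refl)
      fix T assume "T \<in> F"
      then have "linear T" using A(2) lin by auto
      then show "c T *\<^sub>R T (\<Sum>U\<in>G. d U *\<^sub>R U y) = (\<Sum>U\<in>G. (c T * d U) *\<^sub>R T (U y))"
        by (simp add: linear_sum linear_scale scaleR_sum_right)
    qed
    then show ?thesis by (simp add: sum.cartesian_product)
  qed
  moreover have "(\<lambda>y. \<Sum>i\<in>F \<times> G. (c (fst i) * d (snd i)) *\<^sub>R (\<lambda>y. fst i (snd i y)) y) \<in> operator_co S"
  proof (rule operator_co_indexed)
    show "(\<Sum>i\<in>F \<times> G. c (fst i) * d (snd i)) = 1"
      using A(4) B(4) sum_product[of c F d G] by (simp add: sum.cartesian_product split_beta)
    show "(\<lambda>y. fst i (snd i y)) \<in> S" if "i \<in> F \<times> G" for i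
      by (rule comp) (use that A(2) B(2) in auto)
  qed (use A(1,3) B(1,3) in auto)
  ultimately show ?thesis by (simp add: split_beta)
qed

text \<open>Convexity questions about averages of operators thereby become questions about convex hulls of orbits.\<close>

lemma operator_co_orbit:
  "(\<lambda>A. A y) ` operator_co S = convex hull ((\<lambda>T. T y) ` S)"
proof (intro equalityI subsetI)
  fix z assume "z \<in> (\<lambda>A. A y) ` operator_co S"
  then obtain A where A: "A \<in> operator_co S" "z = A y" by auto
  obtain F c where F: "finite F" "F \<subseteq> S" "\<And>T. T \<in> F \<Longrightarrow> 0 \<le> c T" "sum c F = 1"
      "\<And>y. A y = (\<Sum>T\<in>F. c T *\<^sub>R T y)"
    by (rule operator_coE[OF A(1)]) blast
  show "z \<in> convex hull ((\<lambda>T. T y) ` S)"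
    unfolding A(2) F(5) using F(1,3,4)
    by (intro convex_sum convex_convex_hull hull_inc) (use F(2) in auto)
next
  fix z assume "z \<in> convex hull ((\<lambda>T. T y) ` S)"
  then obtain D u where D: "finite D" "D \<subseteq> (\<lambda>T. T y) ` S" "\<And>v. v \<in> D \<Longrightarrow> 0 \<le> u v" "sum u D = 1"
      "(\<Sum>v\<in>D. u v *\<^sub>R v) = z"
    unfolding convex_hull_explicit by auto
  have "\<forall>v\<in>D. \<exists>T\<in>S. T y = v" using D(2) by auto
  then obtain T where T: "\<And>v. v \<in> D \<Longrightarrow> T v \<in> S" "\<And>v. v \<in> D \<Longrightarrow> T v y = v" by metis
  have "(\<lambda>y. \<Sum>v\<in>D. u v *\<^sub>R T v y) \<in> operator_co S"
    using D T by (intro operator_co_indexed) auto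
  moreover have "z = (\<Sum>v\<in>D. u v *\<^sub>R T v y)" using D(5) T(2) by simp
  ultimately show "z \<in> (\<lambda>A. A y) ` operator_co S" by (intro image_eqI)
qed

lemma operator_co_in_convex:
  assumes "A \<in> operator_co S" "convex C" "\<And>T. T \<in> S \<Longrightarrow> T y \<in> C"
  shows "A y \<in> C"
proof -
  have "A y \<in> convex hull ((\<lambda>T. T y) ` S)" using operator_co_orbit[of y S] assms(1) by blast
  then show ?thesis using hull_minimal[of "(\<lambda>T. T y) ` S" C convex] assms by blast
qed

lemma linear_operator_co:
  assumes "A \<in> operator_co S" "\<And>T. T \<in> S \<Longrightarrow> linear T"
  shows "linear A"
proof -
  obtain F c where F: "finite F" "F \<subseteq> S" "\<And>y. A y = (\<Sum>T\<in>F. c T *\<^sub>R T y)"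
    by (rule operator_coE[OF assms(1)]) blast
  have "A = (\<lambda>y. \<Sum>T\<in>F. c T *\<^sub>R T y)" using F(3) by auto
  then show ?thesis
    using F(2) assms(2) by (auto intro!: linear_compose_sum linear_compose_scale_right)
qed

text \<open>The supremum of two filters is the union of the two nets. As a convergent union forces both parts to
  have the same limit, this compares the limits along different ergodic nets.\<close>

lemma left_ergodic_net_sup:
  assumes "left_ergodic_net S F" "left_ergodic_net S G"
  shows "left_ergodic_net S (sup F G)"
  using assms unfolding left_ergodic_net_def
  by (auto simp: eventually_sup filterlim_sup)

lemma right_ergodic_net_sup:
  assumes "right_ergodic_net S F" "right_ergodic_net S G"
  shows "right_ergodic_net S (sup F G)"
  using assms unfolding right_ergodic_net_def
  by (auto simp: eventually_sup filterlim_sup)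

section \<open>The dual of the space of continuous functions\<close>

lemma continuous_apply_bcontfun:
  fixes x :: "'a::topological_space"
  shows "continuous_on UNIV (\<lambda>f :: 'a \<Rightarrow>\<^sub>C 'b::real_normed_vector. apply_bcontfun f x)"
proof -
  have "bounded_linear (\<lambda>f :: 'a \<Rightarrow>\<^sub>C 'b. apply_bcontfun f x)"
    by (rule bounded_linear_intro[where K = 1]) (auto simp: norm_bounded)
  then show ?thesis by (rule linear_continuous_on)
qed

lemma scaleC_of_real: "scaleC_bcontfun (of_real r) f = r *\<^sub>R f"
  by (rule bcontfun_eqI) (simp add: scaleR_conv_of_real)

lemma apply_dual_scaleR_arg: "apply_dual \<mu> (r *\<^sub>R f) = r *\<^sub>R apply_dual \<mu> f"
  using apply_dual_scaleC[of \<mu> "of_real r" f] by (simp add: scaleC_of_real scaleR_conv_of_real)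

lemma linear_apply_dual: "linear (apply_dual \<mu>)"
  by (rule linearI) (auto simp: apply_dual_add apply_dual_scaleR_arg)

lemma bounded_linear_apply_dual: "bounded_linear (apply_dual \<mu>)"
proof -
  obtain B where "\<And>f. norm (apply_dual \<mu> f) \<le> B * norm f" using apply_dual_bounded by metis
  then show ?thesis
    by (intro bounded_linear_intro[where K = B]) (auto simp: apply_dual_add apply_dual_scaleR_arg mult.commute)
qed

text \<open>The imaginary part of \<open>\<mu>(f)\<close> is the real part of \<open>\<mu>(- \<i> f)\<close>. It is therefore enough to work with real
  parts of functionals, to which order arguments apply.\<close>

lemma cb_dual_eq_if_Re:
  assumes "\<And>f. Re (apply_dual \<mu> f) = Re (apply_dual \<nu> f)"
  shows "\<mu> = \<nu>"
proof (rule cb_dual_eqI)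
  fix f
  have "Im (apply_dual \<rho> f) = Re (apply_dual \<rho> (scaleC_bcontfun (- \<i>) f))" for \<rho> :: "'a cb_dual"
    by (simp add: apply_dual_scaleC)
  then show "apply_dual \<mu> f = apply_dual \<nu> f" using assms by (auto simp: complex_eq_iff)
qed

lemma continuous_apply_dual: "continuous_on UNIV (\<lambda>\<mu> :: 'a::topological_space cb_dual. apply_dual \<mu> f)"
  unfolding continuous_on_open_vimage[OF open_UNIV]
proof (intro allI impI)
  fix V :: "complex set" assume "open V"
  then show "open ((\<lambda>\<mu> :: 'a cb_dual. apply_dual \<mu> f) -` V \<inter> UNIV)"
    unfolding open_cb_dual_def by (auto intro: generate_topology.Basis)
qed

lemma tendsto_cb_dual_iff:
  "((\<lambda>x. \<mu> x) \<longlongrightarrow> \<nu>) F \<longleftrightarrow> (\<forall>f. ((\<lambda>x. apply_dual (\<mu> x) f) \<longlongrightarrow> apply_dual \<nu> f) F)"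
proof (intro iffI allI)
  fix f assume "(\<mu> \<longlongrightarrow> \<nu>) F"
  then show "((\<lambda>x. apply_dual (\<mu> x) f) \<longlongrightarrow> apply_dual \<nu> f) F"
    by (intro continuous_on_tendsto_compose[OF continuous_apply_dual]) auto
next
  assume lim: "\<forall>f. ((\<lambda>x. apply_dual (\<mu> x) f) \<longlongrightarrow> apply_dual \<nu> f) F"
  show "(\<mu> \<longlongrightarrow> \<nu>) F"
  proof (rule topological_tendstoI)
    fix U assume U: "open U" "\<nu> \<in> U"
    have "generate_topology {(\<lambda>\<mu>. apply_dual \<mu> f) -` V | f V. open (V :: complex set)} U"
      using U(1) by (simp add: open_cb_dual_def)
    then show "eventually (\<lambda>x. \<mu> x \<in> U) F" using U(2)
    proof (induction rule: generate_topology.induct)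
      case (Int a b)
      then show ?case by (auto simp: eventually_conj_iff)
    next
      case (UN K)
      then obtain k where k: "k \<in> K" "\<nu> \<in> k" by auto
      from UN.IH[OF k] show ?case by (rule eventually_mono) (use k in auto)
    next
      case (Basis s)
      then obtain f V where "s = (\<lambda>\<mu>. apply_dual \<mu> f) -` V" "open V" by auto
      with Basis lim show ?case by (auto dest: topological_tendstoD)
    qed simp
  qed
qed

text \<open>Linearity passes to pointwise limits, and the uniform bound makes the limit bounded.\<close>

lemma tendsto_Abs_dual_pointwise_limit:
  assumes G: "G \<noteq> bot" and lim: "\<And>f. ((\<lambda>x. apply_dual (\<nu> x) f) \<longlongrightarrow> \<Lambda> f) G"
    and bound: "\<And>f. \<forall>\<^sub>F x in G. norm (apply_dual (\<nu> x) f) \<le> K * norm f"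
  shows "(\<nu> \<longlongrightarrow> Abs_dual \<Lambda>) G"
proof -
  have "apply_dual (Abs_dual \<Lambda>) = \<Lambda>"
  proof (rule apply_dual_Abs_dual)
    show "\<Lambda> (f + g) = \<Lambda> f + \<Lambda> g" for f g
      using tendsto_add[OF lim[of f] lim[of g]] by (intro tendsto_unique[OF G lim]) (simp add: apply_dual_add)
    show "\<Lambda> (scaleC_bcontfun c f) = c * \<Lambda> f" for c f
      using tendsto_mult_left[OF lim[of f], of c] by (intro tendsto_unique[OF G lim]) (simp add: apply_dual_scaleC)
    show "norm (\<Lambda> f) \<le> K * norm f" for f
      by (rule tendsto_upperbound[OF tendsto_norm[OF lim] bound G])
  qed
  then show ?thesis by (simp add: tendsto_cb_dual_iff lim)
qed

lemma integrable_apply_bcontfun: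
  fixes f :: "'k::topological_space \<Rightarrow>\<^sub>C complex"
  assumes "prob_space M" "sets M = sets borel"
  shows "integrable M (apply_bcontfun f)"
proof -
  interpret prob_space M by fact
  have "apply_bcontfun f \<in> borel_measurable M"
    using borel_measurable_continuous_onI[OF continuous_on_apply_bcontfun]
      measurable_cong_sets[OF assms(2) refl] by blast
  then show ?thesis
    by (intro integrable_const_bound[where B = "norm f"] AE_I2 norm_bounded)
qed

lemma probability_measure_Re_le:
  assumes \<mu>: "is_probability_measure \<mu>" and f: "\<And>x. Re (apply_bcontfun f x) \<le> c"
  shows "Re (apply_dual \<mu> f) \<le> c"
proof -
  obtain M where M: "prob_space M" "regular_borel_measure M"
      "\<And>f. apply_dual \<mu> f = (LINT x|M. apply_bcontfun f x)"
    using \<mu> unfolding is_probability_measure_def by blast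
  interpret prob_space M by fact
  have int: "integrable M (apply_bcontfun f)"
    using M(2) by (intro integrable_apply_bcontfun M(1)) (simp add: regular_borel_measure_def)
  have "Re (apply_dual \<mu> f) = (LINT x|M. Re (apply_bcontfun f x))"
    unfolding M(3) by (rule integral_Re[symmetric, OF int])
  also have "\<dots> \<le> c"
    using int f by (intro integral_le_const integrable_Re AE_I2) auto
  finally show ?thesis .
qed

text \<open>A real-linear functional below the supremum of the real part depends only on \<open>Re f\<close>, because it is at
  most \<open>0\<close> on both \<open>\<i> g\<close> and \<open>- \<i> g\<close> for real \<open>g\<close>. On real functions it is positive and normalised, so the
  representing measure is available.\<close>

lemma probability_measure_exists:
  fixes \<phi> :: "('k::t2_space \<Rightarrow>\<^sub>C complex) \<Rightarrow> real"
  assumes K: "compact (UNIV :: 'k set)" and lin: "linear \<phi>"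
    and le: "\<And>f c. (\<And>x. Re (apply_bcontfun f x) \<le> c) \<Longrightarrow> \<phi> f \<le> c"
  obtains \<mu> where "is_probability_measure \<mu>" "\<And>f. Re (apply_dual \<mu> f) = \<phi> f"
proof -
  define E where "E g = Bcontfun (\<lambda>x. complex_of_real (g x))" for g :: "'k \<Rightarrow> real"
  have E: "apply_bcontfun (E g) x = complex_of_real (g x)" if "continuous_on UNIV g" for g x
  proof -
    have c: "continuous_on UNIV (\<lambda>x. complex_of_real (g x))" using that by (intro continuous_intros)
    have "(\<lambda>x. complex_of_real (g x)) \<in> bcontfun"
      using c compact_imp_bounded[OF compact_continuous_image[OF c K]] by (simp add: bcontfun_def)
    then show ?thesis by (simp add: E_def Bcontfun_inverse)
  qed
  have ge: "c \<le> \<phi> f" if "\<And>x. c \<le> Re (apply_bcontfun f x)" for f c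
    using le[of "- f" "- c"] that linear_neg[OF lin, of f] by simp
  define L where "L g = \<phi> (E g)" for g
  interpret riesz_functional L
  proof
    show "compact (UNIV :: 'k set)" by (rule K)
    fix f g :: "'k \<Rightarrow> real" and c :: real
    assume f: "continuous_on UNIV f"
    show "L (\<lambda>x. f x + g x) = L f + L g" if g: "continuous_on UNIV g"
    proof -
      have "E (\<lambda>x. f x + g x) = E f + E g"
        using f g by (intro bcontfun_eqI) (simp add: E continuous_on_add)
      then show ?thesis by (simp add: L_def linear_add[OF lin])
    qed
    have "E (\<lambda>x. c * f x) = c *\<^sub>R E f"
      using f by (intro bcontfun_eqI) (simp add: E continuous_on_mult_left scaleR_conv_of_real)
    then show "L (\<lambda>x. c * f x) = c * L f" by (simp add: L_def linear_scale[OF lin])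
    show "0 \<le> L f" if "\<And>x. 0 \<le> f x"
      unfolding L_def using that f by (intro ge) (simp add: E)
  next
    show "L (\<lambda>x. 1) = 1"
      unfolding L_def by (intro antisym le ge) (simp_all add: E)
  qed
  define \<mu> where "\<mu> = Abs_dual (\<lambda>f :: 'k \<Rightarrow>\<^sub>C complex. LINT x|representing_measure. apply_bcontfun f x)"
  interpret M: prob_space representing_measure by (rule prob_representing_measure)
  note int = integrable_apply_bcontfun[OF prob_representing_measure sets_representing_measure]
  have \<mu>: "apply_dual \<mu> = (\<lambda>f. LINT x|representing_measure. apply_bcontfun f x)"
    unfolding \<mu>_def
  proof (rule apply_dual_Abs_dual[where B = 1])
    fix f :: "'k \<Rightarrow>\<^sub>C complex"
    have "norm (LINT x|representing_measure. apply_bcontfun f x) \<le> (LINT x|representing_measure. norm (apply_bcontfun f x))"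
      by (rule integral_norm_bound)
    also have "\<dots> \<le> norm f"
      using int by (intro M.integral_le_const integrable_norm AE_I2 norm_bounded)
    finally show "norm (LINT x|representing_measure. apply_bcontfun f x) \<le> 1 * norm f" by simp
  next
    fix c and f :: "'k \<Rightarrow>\<^sub>C complex"
    have "apply_bcontfun (scaleC_bcontfun c f) = (\<lambda>x. c * apply_bcontfun f x)"
      by (rule ext) simp
    then show "(LINT x|representing_measure. apply_bcontfun (scaleC_bcontfun c f) x) = c * (LINT x|representing_measure. apply_bcontfun f x)"
      by simp
  qed (simp add: int)
  show ?thesis
  proof
    show "is_probability_measure \<mu>"
      unfolding is_probability_measure_def \<mu> by (intro exI[of _ representing_measure] conjI allI refl prob_representing_measure regular_representing_measure)
    fix f :: "'k \<Rightarrow>\<^sub>C complex"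
    have c: "continuous_on UNIV (\<lambda>x. Re (apply_bcontfun f x))"
      by (intro continuous_intros continuous_on_apply_bcontfun)
    have "Re (apply_dual \<mu> f) = (LINT x|representing_measure. Re (apply_bcontfun f x))"
      unfolding \<mu> by (rule integral_Re[symmetric, OF int])
    also have "\<dots> = \<phi> (E (\<lambda>x. Re (apply_bcontfun f x)))"
      using L_eq_integral[OF c] by (simp add: L_def)
    also have "\<dots> = \<phi> f"
    proof -
      let ?h = "f - E (\<lambda>x. Re (apply_bcontfun f x))"
      have "\<phi> ?h = 0"
        by (intro antisym le ge) (simp_all add: E[OF c])
      then show ?thesis by (simp add: linear_diff[OF lin])
    qed
    finally show "Re (apply_dual \<mu> f) = \<phi> f" .
  qed
qed

section \<open>The Koopman semigroup and its coboundaries\<close>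

text \<open>Ergodic nets consist of limits of averages, not of averages. This transfers closed conditions to them.\<close>

lemma closure_induct:
  assumes "A \<in> closure X" "closed {A. P A}" "\<And>A. A \<in> X \<Longrightarrow> P A"
  shows "P A"
  using closure_minimal[of X "{A. P A}"] assms by blast

locale dynamical_system =
  fixes act :: "'s::semitopological_semigroup \<Rightarrow> 'k::t2_space \<Rightarrow> 'k"
  assumes tds: "topological_dynamical_system act"
begin

abbreviation koop ("T") where "T \<equiv> koopman act"

definition co where "co = operator_co (koopman_semigroup act)"

text \<open>The generators are closed under complex multiples, so their real span is already a complex subspace.\<close>

definition coboundaries :: "('k \<Rightarrow>\<^sub>C complex) set" where
  "coboundaries = span {f - T s f | s f. True}"

lemma apply_T [simp]: "apply_bcontfun (T s f) x = apply_bcontfun f (act s x)"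
  by (rule apply_koopman[OF tds])

lemma compact_phase_space: "compact (UNIV :: 'k set)"
  using tds by (simp add: topological_dynamical_system_def)

lemma T_T: "T s (T t f) = T (t * s) f"
  using tds by (intro bcontfun_eqI) (simp add: topological_dynamical_system_def)

lemma linear_T: "linear (T s)"
  by (intro linearI bcontfun_eqI) simp_all

lemma T_scaleC: "T s (scaleC_bcontfun c f) = scaleC_bcontfun c (T s f)"
  by (intro bcontfun_eqI) simp

lemma norm_T_le: "norm (T s f) \<le> norm f"
  by (rule norm_bound) (simp add: norm_bounded)

lemma T_in_co: "T s \<in> co"
  unfolding co_def by (intro operator_co_base) (simp add: koopman_semigroup_def)

lemma linear_co: "A \<in> co \<Longrightarrow> linear A"
  unfolding co_def by (rule linear_operator_co) (auto simp: koopman_semigroup_def linear_T)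

lemma co_comp: "A \<in> co \<Longrightarrow> B \<in> co \<Longrightarrow> (\<lambda>f. A (B f)) \<in> co"
  unfolding co_def
  by (rule operator_co_comp) (auto simp: koopman_semigroup_def linear_T T_T)

lemma co_in_convex: "A \<in> co \<Longrightarrow> convex C \<Longrightarrow> (\<And>s. T s f \<in> C) \<Longrightarrow> A f \<in> C"
  unfolding co_def by (rule operator_co_in_convex) (auto simp: koopman_semigroup_def)

lemma norm_co_le: "A \<in> co \<Longrightarrow> norm (A f) \<le> norm f"
  using co_in_convex[of A "cball 0 (norm f)" f] by (simp add: norm_T_le)

lemma co_scaleC:
  assumes "A \<in> co"
  shows "A (scaleC_bcontfun c f) = scaleC_bcontfun c (A f)"
proof -
  obtain F d where F: "F \<subseteq> koopman_semigroup act" "\<And>f. A f = (\<Sum>U\<in>F. d U *\<^sub>R U f)"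
    by (rule operator_coE[OF assms[unfolded co_def]]) blast
  have lin: "linear (scaleC_bcontfun c :: ('k \<Rightarrow>\<^sub>C complex) \<Rightarrow> _)"
    by (intro linearI bcontfun_eqI) (simp_all add: algebra_simps)
  show ?thesis
    unfolding F(2) using F(1)
    by (auto simp: linear_sum[OF lin] linear_scale[OF lin] koopman_semigroup_def T_scaleC intro!: sum.cong)
qed

lemma co_Re_le:
  assumes "A \<in> co" "\<And>x. Re (apply_bcontfun f x) \<le> c"
  shows "Re (apply_bcontfun (A f) x) \<le> c"
proof -
  have lin: "linear (\<lambda>f :: 'k \<Rightarrow>\<^sub>C complex. Re (apply_bcontfun f x))"
    by (intro linearI) simp_all
  have "A f \<in> (\<lambda>f. Re (apply_bcontfun f x)) -` {..c}"
    by (rule co_in_convex[OF assms(1)]) (use assms(2) in \<open>auto intro: convex_linear_vimage[OF lin]\<close>)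
  then show ?thesis by simp
qed

lemma diff_T_coboundary: "f - T s f \<in> coboundaries"
  unfolding coboundaries_def by (intro span_base) auto

lemma subspace_coboundary: "subspace coboundaries"
  unfolding coboundaries_def by (rule subspace_span)

text \<open>\<open>T\<^sub>t (f - T\<^sub>s f) = (f - T\<^sub>s\<^sub>t f) - (f - T\<^sub>t f)\<close>.\<close>

lemma T_coboundary: "g \<in> coboundaries \<Longrightarrow> T t g \<in> coboundaries"
proof -
  assume "g \<in> coboundaries"
  then show ?thesis
    unfolding coboundaries_def
  proof (induction rule: span_induct_alt)
    case base
    then show ?case by (simp add: linear_0[OF linear_T] span_zero)
  next
    case (step c x y)
    then obtain s f where x: "x = f - T s f" by auto
    have "T t x = (f - T (s * t) f) - (f - T t f)"
      by (simp add: x linear_diff[OF linear_T] T_T)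
    also have "\<dots> \<in> coboundaries"
      by (intro subspace_diff[OF subspace_coboundary] diff_T_coboundary)
    finally have "T t x \<in> coboundaries" .
    then show ?case
      using step(2) by (simp add: linear_add[OF linear_T] linear_scale[OF linear_T] coboundaries_def span_add span_scale)
  qed
qed

lemma co_coboundary: "A \<in> co \<Longrightarrow> g \<in> coboundaries \<Longrightarrow> A g \<in> coboundaries"
  by (rule co_in_convex) (auto simp: T_coboundary, simp add: coboundaries_def subspace_imp_convex)

lemma diff_co_coboundary:
  assumes "A \<in> co"
  shows "f - A f \<in> coboundaries"
proof -
  have "convex {h. f - h \<in> coboundaries}"
  proof (rule convexI)
    fix a b :: "'k \<Rightarrow>\<^sub>C complex" and u v :: real
    assume ab: "a \<in> {h. f - h \<in> coboundaries}" "b \<in> {h. f - h \<in> coboundaries}" and uv: "u + v = 1"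
    have "f - (u *\<^sub>R a + v *\<^sub>R b) = u *\<^sub>R (f - a) + v *\<^sub>R (f - b)"
      using uv by (simp add: algebra_simps flip: scaleR_add_left)
    then show "u *\<^sub>R a + v *\<^sub>R b \<in> {h. f - h \<in> coboundaries}"
      using ab by (simp add: coboundaries_def span_add span_scale)
  qed
  then show ?thesis using co_in_convex[OF assms, of "{h. f - h \<in> coboundaries}" f] diff_T_coboundary by simp
qed

text \<open>Joint continuity of the action and compactness of the phase space make the orbit maps continuous for
  the supremum norm, so that functionals of \<open>T\<^sub>s f\<close> are continuous functions of \<open>s\<close>.\<close>

lemma continuous_orbit_map: "continuous_on UNIV (\<lambda>s. T s f)"
  unfolding continuous_on_def
proof (intro ballI tendstoI)
  fix s0 :: 's and e :: real assume e: "0 < e"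
  have "continuous_on UNIV (\<lambda>p. apply_bcontfun f (case p of (s, x) \<Rightarrow> act s x))"
    using tds by (intro continuous_on_compose2[OF continuous_on_apply_bcontfun])
      (auto simp: topological_dynamical_system_def)
  then have c: "continuous_on (UNIV \<times> UNIV) (\<lambda>p. apply_bcontfun f (case p of (s, x) \<Rightarrow> act s x))"
    by simp
  obtain X where X: "s0 \<in> X" "open X"
      "\<forall>s\<in>X \<inter> UNIV. \<forall>x\<in>UNIV. dist (apply_bcontfun f (case (s, x) of (s, x) \<Rightarrow> act s x))
         (apply_bcontfun f (case (s0, x) of (s, x) \<Rightarrow> act s x)) \<le> e / 2"
    by (rule continuous_on_prod_compactE[OF c compact_phase_space UNIV_I, of "e / 2" s0]) (use e in auto)
  have "dist (T s f) (T s0 f) < e" if "s \<in> X" for s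
  proof -
    have "dist (T s f) (T s0 f) \<le> e / 2"
      by (rule dist_bound) (use X(3) that in auto)
    then show ?thesis using e by simp
  qed
  then show "\<forall>\<^sub>F s in at s0 within UNIV. dist (T s f) (T s0 f) < e"
    using X(1,2) by (auto simp: eventually_at_topological)
qed

end

section \<open>Ergodic nets from amenability\<close>

locale amenable_system = dynamical_system act
  for act :: "'s::semitopological_semigroup \<Rightarrow> 'k::t2_space \<Rightarrow> 'k" +
  assumes amenable: "left_amenable TYPE('s)"
begin

text \<open>\<open>\<Phi> f\<close> is the mean of the function \<open>s \<mapsto> \<phi> (T\<^sub>s f)\<close>. Since \<open>T\<^sub>t T\<^sub>s = T\<^sub>s\<^sub>t\<close>, replacing \<open>f\<close> by \<open>T\<^sub>s f\<close>
  translates this function from the left, which the mean does not see.\<close>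

lemma invariant_average:
  fixes \<phi> :: "('k \<Rightarrow>\<^sub>C complex) \<Rightarrow> real"
  assumes \<phi>: "bounded_linear \<phi>"
  obtains \<Phi> where "linear \<Phi>" "\<And>s f. \<Phi> (T s f) = \<Phi> f"
    "\<And>f c. (\<And>s. \<phi> (T s f) \<le> c) \<Longrightarrow> \<Phi> f \<le> c"
proof -
  obtain m :: "'s cb_dual" where m: "left_invariant_mean m"
    using amenable by (auto simp: left_amenable_def)
  define orb where "orb f = Bcontfun (\<lambda>s. complex_of_real (\<phi> (T s f)))" for f
  have orb: "apply_bcontfun (orb f) s = complex_of_real (\<phi> (T s f))" for f s
  proof -
    obtain B where B: "\<And>g. norm (\<phi> g) \<le> norm g * B" "0 \<le> B"
      using bounded_linear.nonneg_bounded[OF \<phi>] by auto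
    have "(\<lambda>s. complex_of_real (\<phi> (T s f))) \<in> bcontfun"
    proof (rule bcontfun_normI)
      show "continuous_on UNIV (\<lambda>s. complex_of_real (\<phi> (T s f)))"
        by (intro continuous_on_of_real bounded_linear.continuous_on[OF \<phi>] continuous_orbit_map)
      fix s
      have "\<bar>\<phi> (T s f)\<bar> \<le> norm (T s f) * B" using B(1)[of "T s f"] by simp
      also have "\<dots> \<le> norm f * B" using norm_T_le B(2) by (rule mult_right_mono)
      finally show "norm (complex_of_real (\<phi> (T s f))) \<le> norm f * B" by simp
    qed
    then show ?thesis by (simp add: orb_def Bcontfun_inverse)
  qed
  have lin: "linear \<phi>" using \<phi> by (rule bounded_linear.linear)
  define \<Phi> where "\<Phi> f = Re (apply_dual m (orb f))" for f
  show ?thesis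
  proof
    have "orb (f + g) = orb f + orb g" "orb (r *\<^sub>R f) = r *\<^sub>R orb f" for f g r
      by (auto intro!: bcontfun_eqI simp: orb linear_add[OF lin] linear_scale[OF lin]
          linear_add[OF linear_T] linear_scale[OF linear_T] scaleR_conv_of_real)
    then show "linear \<Phi>"
      by (intro linearI) (simp_all add: \<Phi>_def apply_dual_add apply_dual_scaleR_arg)
    fix f
    show "\<Phi> (T s f) = \<Phi> f" for s
    proof -
      have "orb (T s f) = left_translation s (orb f)"
        by (intro bcontfun_eqI) (simp add: orb T_T)
      then show ?thesis using m by (simp add: \<Phi>_def left_invariant_mean_def)
    qed
    show "\<Phi> f \<le> c" if le: "\<And>s. \<phi> (T s f) \<le> c" for c
    proof -
      have "apply_dual m (c *\<^sub>R const_bcontfun 1 - orb f) \<in> \<real>\<^sub>\<ge>\<^sub>0"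
        using m le unfolding left_invariant_mean_def positive_functional_def
        by (auto simp: orb scaleR_conv_of_real complex_nonneg_Reals_iff)
      moreover have "apply_dual m (c *\<^sub>R const_bcontfun 1 - orb f) = c - apply_dual m (orb f)"
        using m by (simp add: linear_diff[OF linear_apply_dual] apply_dual_scaleR_arg
            left_invariant_mean_def scaleR_conv_of_real)
      ultimately show ?thesis by (simp add: \<Phi>_def complex_nonneg_Reals_iff)
    qed
  qed
qed

lemma invariant_vanishes_on_coboundaries:
  assumes "linear \<Phi>" "\<And>s f. \<Phi> (T s f) = \<Phi> f" "g \<in> coboundaries"
  shows "\<Phi> g = 0"
  using assms(3) unfolding coboundaries_def
  by (induction rule: span_induct_alt)
    (use assms(1,2) in \<open>auto simp: linear_0 linear_add linear_scale linear_diff\<close>)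

text \<open>Otherwise a bounded functional \<open>\<phi>\<close> is at least \<open>e\<close> on all averages of \<open>g\<close>, in particular on the orbit
  of \<open>g\<close>. Then the invariant average of \<open>\<phi>\<close> is at least \<open>e\<close> at \<open>g\<close>, although it vanishes on coboundaries.\<close>

lemma small_average:
  assumes g: "g \<in> coboundaries" and e: "0 < e"
  shows "\<exists>A\<in>co. norm (A g) < e"
proof (rule ccontr)
  assume "\<not> ?thesis"
  then have ge: "\<And>f. f \<in> (\<lambda>A. A g) ` co \<Longrightarrow> e \<le> norm f" by (auto simp: not_less)
  have norm: "sublinear (norm :: ('k \<Rightarrow>\<^sub>C complex) \<Rightarrow> real)"
    by (simp add: sublinear_def norm_triangle_ineq)
  have hull: "(\<lambda>A. A g) ` co = convex hull (range (\<lambda>s. T s g))"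
    unfolding co_def operator_co_orbit by (simp add: koopman_semigroup_def image_image)
  have "convex ((\<lambda>A. A g) ` co)" by (simp add: hull convex_convex_hull)
  moreover have "(\<lambda>A. A g) ` co \<noteq> {}" using T_in_co by blast
  ultimately have "\<exists>\<phi>. linear \<phi> \<and> (\<forall>f. \<phi> f \<le> norm f) \<and> (\<forall>f\<in>(\<lambda>A. A g) ` co. e \<le> \<phi> f)"
    by (rule mazur_orlicz[OF norm _ _ ge])
  then obtain \<phi> where \<phi>: "linear \<phi>" "\<And>f. \<phi> f \<le> norm f" "\<And>f. f \<in> (\<lambda>A. A g) ` co \<Longrightarrow> e \<le> \<phi> f"
    by blast
  have "bounded_linear \<phi>"
  proof (rule bounded_linear_intro[where K = 1])
    fix f
    show "norm (\<phi> f) \<le> norm f * 1"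
      using \<phi>(2)[of f] \<phi>(2)[of "- f"] linear_neg[OF \<phi>(1), of f] by auto
  qed (simp_all add: linear_add[OF \<phi>(1)] linear_scale[OF \<phi>(1)])
  then obtain \<Phi> where \<Phi>: "linear \<Phi>" "\<And>s f. \<Phi> (T s f) = \<Phi> f"
      "\<And>f c. (\<And>s. \<phi> (T s f) \<le> c) \<Longrightarrow> \<Phi> f \<le> c"
    by (rule invariant_average) blast
  have "\<Phi> (- g) \<le> - e"
  proof (rule \<Phi>(3))
    fix s
    have "e \<le> \<phi> (T s g)" by (intro \<phi>(3) imageI T_in_co)
    then show "\<phi> (T s (- g)) \<le> - e" by (simp add: linear_neg[OF linear_T] linear_neg[OF \<phi>(1)])
  qed
  moreover have "\<Phi> g = 0" by (rule invariant_vanishes_on_coboundaries[OF \<Phi>(1,2) g])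
  ultimately show False using e by (simp add: linear_neg[OF \<Phi>(1)])
qed

text \<open>An average of a coboundary is again a coboundary, so the averages for the single functions can be
  composed; each further average is a contraction and preserves what was achieved before.\<close>

lemma small_averages:
  assumes "finite G" "G \<subseteq> coboundaries" "0 < e"
  obtains A where "A \<in> co" "\<And>g. g \<in> G \<Longrightarrow> norm (A g) < e"
  using assms
proof (induction G arbitrary: thesis rule: finite_induct)
  case empty
  then show ?case using T_in_co by blast
next
  case (insert g G)
  then obtain A where A: "A \<in> co" "\<And>g. g \<in> G \<Longrightarrow> norm (A g) < e" by blast
  obtain B where B: "B \<in> co" "norm (B (A g)) < e"
    using small_average[OF co_coboundary[OF A(1)], of g e] insert.prems by blast
  show ?case
  proof (rule insert.prems(1)[OF co_comp[OF B(1) A(1)]])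
    fix h assume "h \<in> insert g G"
    then show "norm (B (A h)) < e"
      using B A(2) norm_co_le[OF B(1), of "A h"] by (auto intro: le_less_trans)
  qed
qed

text \<open>The net of all averages in \<open>C\<close>, ordered by how small they are on finitely many coboundaries. Composing
  on the left with \<open>D\<close> brings an average into \<open>C\<close> without enlarging its values.\<close>

lemma right_ergodic_net_exists:
  assumes C: "\<And>A. A \<in> co \<Longrightarrow> \<exists>D\<in>co. (\<lambda>f. D (A f)) \<in> C"
  obtains F where "right_ergodic_net (koopman_semigroup act) F" "\<forall>\<^sub>F A in F. A \<in> co \<and> A \<in> C"
proof -
  define W where "W = (\<lambda>(g, e). {A \<in> co \<inter> C. norm (A g) < e})"
  define F where "F = (INF i\<in>coboundaries \<times> {0<..}. principal (W i))"
  have ne: "F \<noteq> bot"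
    unfolding F_def
  proof (rule INF_filter_not_bot)
    fix X :: "(('k \<Rightarrow>\<^sub>C complex) \<times> real) set" assume X: "X \<subseteq> coboundaries \<times> {0<..}" "finite X"
    define e where "e = Min (insert 1 (snd ` X))"
    have e: "0 < e" using X by (auto simp: e_def)
    obtain A where A: "A \<in> co" "\<And>g. g \<in> fst ` X \<Longrightarrow> norm (A g) < e"
      by (rule small_averages[of "fst ` X" e]) (use X e in auto)
    obtain D where D: "D \<in> co" "(\<lambda>f. D (A f)) \<in> C" using C[OF A(1)] by blast
    have "(\<lambda>f. D (A f)) \<in> W i" if "i \<in> X" for i
    proof -
      have "norm (D (A (fst i))) \<le> norm (A (fst i))" by (rule norm_co_le[OF D(1)])
      also have "\<dots> < e" using A(2) that by auto
      also have "e \<le> snd i" using X(2) that by (auto simp: e_def)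
      finally show ?thesis using co_comp[OF D(1) A(1)] D(2) by (simp add: W_def case_prod_beta)
    qed
    then have "(\<Inter>i\<in>X. W i) \<noteq> {}" by blast
    then show "(INF i\<in>X. principal (W i)) \<noteq> bot"
      by (simp add: INF_principal_finite[OF X(2)] principal_eq_bot_iff)
  qed
  have ev: "\<forall>\<^sub>F A in F. A \<in> W (g, e)" if "g \<in> coboundaries" "0 < e" for g e
    unfolding F_def by (rule eventually_INF1[of "(g, e)"]) (use that in \<open>auto simp: eventually_principal\<close>)
  have "(0 :: 'k \<Rightarrow>\<^sub>C complex) \<in> coboundaries" by (simp add: coboundaries_def span_zero)
  from ev[OF this, of 1] have evC: "\<forall>\<^sub>F A in F. A \<in> co \<and> A \<in> C"
    by (auto simp: W_def elim: eventually_mono)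
  have "right_ergodic_net (koopman_semigroup act) F"
    unfolding right_ergodic_net_def
  proof (intro conjI ne allI ballI tendstoI)
    show "\<forall>\<^sub>F A in F. A \<in> closure (operator_co (koopman_semigroup act))"
      using evC by (rule eventually_mono) (use closure_subset in \<open>auto simp: co_def\<close>)
    fix f U and e :: real assume "U \<in> koopman_semigroup act" and e: "0 < e"
    then obtain s where U: "U = T s" by (auto simp: koopman_semigroup_def)
    show "\<forall>\<^sub>F A in F. dist (A (f - U f)) 0 < e"
      unfolding U using ev[OF diff_T_coboundary e] by (rule eventually_mono) (auto simp: W_def)
  qed
  then show ?thesis using evC that by blast
qed

end

context dynamical_system begin

lemma apply_dual_co:
  assumes "A \<in> co"
  shows "apply_dual (dual_operator A \<mu>) f = apply_dual \<mu> (A f)"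
  by (rule apply_dual_operator[where C = 1])
    (simp_all add: linear_add[OF linear_co[OF assms]] co_scaleC[OF assms] norm_co_le[OF assms])

lemma linear_eval_dual: "linear (\<lambda>\<mu> :: 'k cb_dual. apply_dual \<mu> f)"
  by (intro linearI) simp_all

lemma dual_co:
  assumes "A \<in> co"
  shows "dual_operator A \<in> operator_co (dual_koopman_semigroup act)"
proof -
  obtain F c where F: "finite F" "F \<subseteq> koopman_semigroup act" "\<And>U. U \<in> F \<Longrightarrow> 0 \<le> c U" "sum c F = 1"
      "\<And>f. A f = (\<Sum>U\<in>F. c U *\<^sub>R U f)"
    by (rule operator_coE[OF assms[unfolded co_def]]) blast
  have Fco: "U \<in> co" if "U \<in> F" for U
    using that F(2) T_in_co by (auto simp: koopman_semigroup_def)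
  have "dual_operator A = (\<lambda>\<mu>. \<Sum>U\<in>F. c U *\<^sub>R dual_operator U \<mu>)"
  proof (intro ext cb_dual_eqI)
    fix \<mu> f
    have "apply_dual (dual_operator A \<mu>) f = (\<Sum>U\<in>F. c U *\<^sub>R apply_dual \<mu> (U f))"
      unfolding apply_dual_co[OF assms] F(5)
      by (simp add: linear_sum[OF linear_apply_dual] apply_dual_scaleR_arg)
    also have "\<dots> = (\<Sum>U\<in>F. apply_dual (c U *\<^sub>R dual_operator U \<mu>) f)"
      using Fco by (intro sum.cong) (auto simp: apply_dual_co)
    also have "\<dots> = apply_dual (\<Sum>U\<in>F. c U *\<^sub>R dual_operator U \<mu>) f"
      by (rule linear_sum[OF linear_eval_dual, symmetric])
    finally show "apply_dual (dual_operator A \<mu>) f = apply_dual (\<Sum>U\<in>F. c U *\<^sub>R dual_operator U \<mu>) f" .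
  qed
  then show ?thesis
    using F by (auto intro!: operator_co_indexed simp: dual_koopman_semigroup_def)
qed

text \<open>For averages \<open>A\<close>, the adjoint \<open>A'\<close> satisfies \<open>(A' \<mu> - T\<^sub>s' A' \<mu>)(f) = \<mu>(A (f - T\<^sub>s f))\<close>.\<close>

lemma dual_ergodic_net:
  assumes F: "right_ergodic_net (koopman_semigroup act) F" and co: "\<forall>\<^sub>F A in F. A \<in> co"
  shows "left_ergodic_net (dual_koopman_semigroup act) (filtermap dual_operator F)"
  unfolding left_ergodic_net_def
proof (intro conjI allI ballI)
  show "filtermap dual_operator F \<noteq> bot"
    using F by (simp add: right_ergodic_net_def filtermap_bot_iff)
  show "\<forall>\<^sub>F B in filtermap dual_operator F. B \<in> closure (operator_co (dual_koopman_semigroup act))"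
    unfolding eventually_filtermap using co
    by (rule eventually_mono) (use dual_co closure_subset in blast)
  fix \<mu> and U assume "U \<in> dual_koopman_semigroup act"
  then obtain s where U: "U = dual_operator (T s)"
    by (auto simp: dual_koopman_semigroup_def koopman_semigroup_def)
  show "((\<lambda>B. B \<mu> - U (B \<mu>)) \<longlongrightarrow> 0) (filtermap dual_operator F)"
    unfolding filterlim_filtermap tendsto_cb_dual_iff
  proof
    fix f
    have "((\<lambda>A. A (f - T s f)) \<longlongrightarrow> 0) F"
      using F by (auto simp: right_ergodic_net_def koopman_semigroup_def)
    then have "((\<lambda>A. apply_dual \<mu> (A (f - T s f))) \<longlongrightarrow> apply_dual \<mu> 0) F"
      by (rule bounded_linear.tendsto[OF bounded_linear_apply_dual])
    moreover have "\<forall>\<^sub>F A in F. apply_dual \<mu> (A (f - T s f)) =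
        apply_dual (dual_operator A \<mu> - U (dual_operator A \<mu>)) f"
      using co
    proof (rule eventually_mono)
      fix A assume A: "A \<in> co"
      show "apply_dual \<mu> (A (f - T s f)) = apply_dual (dual_operator A \<mu> - U (dual_operator A \<mu>)) f"
        by (simp add: U apply_dual_co[OF A] apply_dual_co[OF T_in_co] linear_diff[OF linear_co[OF A]]
            linear_diff[OF linear_apply_dual])
    qed
    ultimately show "((\<lambda>A. apply_dual (dual_operator A \<mu> - U (dual_operator A \<mu>)) f) \<longlongrightarrow> apply_dual 0 f) F"
      by (simp add: linear_0[OF linear_apply_dual] tendsto_cong)
  qed
qed

end

section \<open>Unique ergodicity implies norm mean ergodicity\<close>

context dynamical_system begin

lemma closure_co_linear:
  assumes "A \<in> closure co"
  shows "linear A"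
proof (rule linearI)
  note cont = continuous_on_product_coordinates
  show "A (f + g) = A f + A g" for f g
  proof (rule closure_induct[OF assms])
    show "closed {A :: ('k \<Rightarrow>\<^sub>C complex) \<Rightarrow> 'k \<Rightarrow>\<^sub>C complex. A (f + g) = A f + A g}"
      by (rule closed_Collect_eq[OF cont continuous_on_add[OF cont cont]])
  qed (rule linear_add[OF linear_co])
  show "A (r *\<^sub>R f) = r *\<^sub>R A f" for f r
  proof (rule closure_induct[OF assms])
    show "closed {A :: ('k \<Rightarrow>\<^sub>C complex) \<Rightarrow> 'k \<Rightarrow>\<^sub>C complex. A (r *\<^sub>R f) = r *\<^sub>R A f}"
      by (rule closed_Collect_eq[OF cont continuous_on_scaleR[OF continuous_on_const cont]])
  qed (rule linear_scale[OF linear_co])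
qed

lemma continuous_operator_eval: "continuous_on UNIV (\<lambda>A :: ('k \<Rightarrow>\<^sub>C complex) \<Rightarrow> 'k \<Rightarrow>\<^sub>C complex. apply_bcontfun (A f) x)"
  using continuous_on_compose2[OF continuous_apply_bcontfun continuous_on_product_coordinates[of f], of x]
  by simp

lemma closure_co_scaleC:
  assumes "A \<in> closure co"
  shows "A (scaleC_bcontfun c f) = scaleC_bcontfun c (A f)"
proof (rule bcontfun_eqI)
  fix x
  have "apply_bcontfun (A (scaleC_bcontfun c f)) x = c * apply_bcontfun (A f) x"
  proof (rule closure_induct[OF assms])
    show "closed {A. apply_bcontfun (A (scaleC_bcontfun c f)) x = c * apply_bcontfun (A f) x}"
      by (rule closed_Collect_eq[OF continuous_operator_eval continuous_on_mult_left[OF continuous_operator_eval]])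
  qed (simp add: co_scaleC)
  then show "apply_bcontfun (A (scaleC_bcontfun c f)) x = apply_bcontfun (scaleC_bcontfun c (A f)) x"
    by simp
qed

lemma closure_co_Re_le:
  assumes "A \<in> closure co" "\<And>x. Re (apply_bcontfun f x) \<le> c"
  shows "Re (apply_bcontfun (A f) x) \<le> c"
proof (rule closure_induct[OF assms(1)])
  show "closed {A. Re (apply_bcontfun (A f) x) \<le> c}"
    by (rule closed_Collect_le[OF continuous_on_Re[OF continuous_operator_eval] continuous_on_const])
qed (rule co_Re_le, assumption, rule assms(2))

lemma right_ergodic_tendsto_coboundary:
  assumes F: "right_ergodic_net (koopman_semigroup act) F" and g: "g \<in> coboundaries"
  shows "((\<lambda>A. A g) \<longlongrightarrow> 0) F"
proof -
  have ev: "\<forall>\<^sub>F A in F. linear A"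
    using F by (auto simp: right_ergodic_net_def co_def[symmetric] intro: closure_co_linear elim: eventually_mono)
  show ?thesis
    using g unfolding coboundaries_def
  proof (induction rule: span_induct_alt)
    case base
    show ?case
      by (rule tendsto_eventually) (rule eventually_mono[OF ev], rule linear_0)
  next
    case (step c x y)
    then have "((\<lambda>A. A x) \<longlongrightarrow> 0) F"
      using F by (auto simp: right_ergodic_net_def koopman_semigroup_def)
    then have "((\<lambda>A. c *\<^sub>R A x + A y) \<longlongrightarrow> c *\<^sub>R 0 + 0) F"
      by (intro tendsto_intros step.IH)
    moreover have "\<forall>\<^sub>F A in F. c *\<^sub>R A x + A y = A (c *\<^sub>R x + y)"
      using ev by (rule eventually_mono) (simp add: linear_add linear_scale)
    ultimately show ?case by (simp add: tendsto_cong)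
  qed
qed

lemma invariant_probability_exists:
  assumes lin: "linear \<phi>" and le: "\<And>f c. (\<And>x. Re (apply_bcontfun f x) \<le> c) \<Longrightarrow> \<phi> f \<le> c"
    and inv: "\<And>s f. \<phi> (T s f) = \<phi> f"
  obtains \<mu> where "is_probability_measure \<mu>" "\<And>s. dual_operator (T s) \<mu> = \<mu>"
    "\<And>f. Re (apply_dual \<mu> f) = \<phi> f"
proof -
  obtain \<mu> where \<mu>: "is_probability_measure \<mu>" "\<And>f. Re (apply_dual \<mu> f) = \<phi> f"
    by (rule probability_measure_exists[OF compact_phase_space lin le]) blast+
  have "dual_operator (T s) \<mu> = \<mu>" for s
    by (rule cb_dual_eq_if_Re) (simp add: apply_dual_koopman[OF tds] \<mu>(2) inv)
  with \<mu> that show ?thesis by blast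
qed

lemma bdd_above_Re: "bdd_above (range (\<lambda>x. Re (apply_bcontfun f x)))"
  for f :: "'a::topological_space \<Rightarrow>\<^sub>C complex"
  by (rule bdd_aboveI2[where M = "norm f"]) (meson abs_Re_le_cmod abs_le_D1 norm_bounded order_trans)

lemma sublinear_sup: "sublinear (\<lambda>f :: 'k \<Rightarrow>\<^sub>C complex. SUP x. Re (apply_bcontfun f x))"
proof -
  note upper = cSUP_upper[OF UNIV_I bdd_above_Re]
  show ?thesis
  proof (rule sublinearI)
    fix f g :: "'k \<Rightarrow>\<^sub>C complex"
    show "(SUP x. Re (apply_bcontfun (f + g) x)) \<le> (SUP x. Re (apply_bcontfun f x)) + (SUP x. Re (apply_bcontfun g x))"
      by (rule cSUP_least) (use upper in \<open>auto intro: add_mono\<close>)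
  next
    fix t :: real and f :: "'k \<Rightarrow>\<^sub>C complex" assume "0 < t"
    then show "(SUP x. Re (apply_bcontfun (t *\<^sub>R f) x)) \<le> t * (SUP x. Re (apply_bcontfun f x))"
      by (intro cSUP_least) (use upper in \<open>auto intro: mult_left_mono\<close>)
  qed simp
qed

text \<open>If the assertion fails, \<open>sup Re \<ge> d\<close> on the affine space \<open>f + N\<close>, where \<open>N\<close> is the space of
  coboundaries. A linear functional that is bounded below on \<open>f + N\<close> vanishes on \<open>N\<close>, so the one given by
  the Mazur-Orlicz theorem is a second invariant probability measure.\<close>

lemma uniquely_ergodic_upper_bound:
  assumes uniq: "\<And>\<nu>. is_probability_measure \<nu> \<Longrightarrow> (\<And>s. dual_operator (T s) \<nu> = \<nu>) \<Longrightarrow> \<nu> = \<mu>"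
    and e: "0 < e"
  shows "\<exists>h\<in>coboundaries. \<forall>x. Re (apply_bcontfun (f + h) x) \<le> Re (apply_dual \<mu> f) + e"
proof (rule ccontr)
  assume neg: "\<not> ?thesis"
  define d where "d = Re (apply_dual \<mu> f) + e"
  define p where "p u = (SUP x. Re (apply_bcontfun u x))" for u :: "'k \<Rightarrow>\<^sub>C complex"
  have p: "sublinear p" unfolding p_def by (rule sublinear_sup)
  define C where "C = (\<lambda>h. f + h) ` coboundaries"
  have "convex C"
    unfolding C_def by (intro convex_translation subspace_imp_convex subspace_coboundary)
  moreover have "C \<noteq> {}" using subspace_0[OF subspace_coboundary] by (auto simp: C_def)
  moreover have "d \<le> p u" if "u \<in> C" for u
  proof -
    obtain h where "h \<in> coboundaries" "u = f + h" using \<open>u \<in> C\<close> by (auto simp: C_def)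
    then obtain x where "d < Re (apply_bcontfun u x)"
      using neg by (auto simp: d_def not_le)
    also have "\<dots> \<le> p u" unfolding p_def by (rule cSUP_upper[OF UNIV_I bdd_above_Re])
    finally show ?thesis by simp
  qed
  ultimately have "\<exists>\<phi>. linear \<phi> \<and> (\<forall>u. \<phi> u \<le> p u) \<and> (\<forall>u\<in>C. d \<le> \<phi> u)"
    by (rule mazur_orlicz[OF p])
  then obtain \<phi> where \<phi>: "linear \<phi>" "\<And>u. \<phi> u \<le> p u" "\<And>u. u \<in> C \<Longrightarrow> d \<le> \<phi> u"
    by blast
  have zero: "\<phi> h = 0" if "h \<in> coboundaries" for h
  proof (rule ccontr)
    assume nz: "\<phi> h \<noteq> 0"
    \<comment> \<open>with this factor the value at \<open>f + t h\<close> would be \<open>d - 1\<close>\<close>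
    define t where "t = (d - 1 - \<phi> f) / \<phi> h"
    have "d \<le> \<phi> (f + t *\<^sub>R h)"
      using that by (intro \<phi>(3)) (simp add: C_def subspace_scale[OF subspace_coboundary])
    also have "\<dots> = d - 1"
      using nz by (simp add: linear_add[OF \<phi>(1)] linear_scale[OF \<phi>(1)] t_def)
    finally show False by simp
  qed
  have "\<phi> u \<le> c" if "\<And>x. Re (apply_bcontfun u x) \<le> c" for u c
    using \<phi>(2)[of u] cSUP_least[of UNIV "\<lambda>x. Re (apply_bcontfun u x)" c] that by (simp add: p_def)
  moreover have "\<phi> (T s u) = \<phi> u" for s u
    using zero[OF diff_T_coboundary[of u s]] by (simp add: linear_diff[OF \<phi>(1)])
  ultimately obtain \<nu> where \<nu>: "is_probability_measure \<nu>" "\<And>s. dual_operator (T s) \<nu> = \<nu>"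
      "\<And>u. Re (apply_dual \<nu> u) = \<phi> u"
    by (rule invariant_probability_exists[OF \<phi>(1)]) blast+
  have "\<nu> = \<mu>" using \<nu>(1,2) by (rule uniq)
  moreover have "d \<le> \<phi> f"
    using subspace_0[OF subspace_coboundary] by (intro \<phi>(3)) (force simp: C_def)
  ultimately show False using \<nu>(3)[of f] e by (simp add: d_def)
qed

theorem uniquely_ergodic_imp_norm_mean_ergodic:
  assumes "uniquely_ergodic act"
  shows "norm_mean_ergodic act"
  unfolding norm_mean_ergodic_def right_mean_ergodic_def
proof (intro allI impI)
  fix F f assume F: "right_ergodic_net (koopman_semigroup act) F"
  obtain \<mu> where uniq: "\<And>\<nu>. is_probability_measure \<nu> \<Longrightarrow> (\<And>s. dual_operator (T s) \<nu> = \<nu>) \<Longrightarrow> \<nu> = \<mu>"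
    using assms unfolding uniquely_ergodic_def by blast
  have cl: "\<forall>\<^sub>F A in F. A \<in> closure co"
    using F by (simp add: right_ergodic_net_def co_def)
  have one_sided: "\<forall>\<^sub>F A in F. \<forall>x. Re (apply_bcontfun (A f) x) \<le> Re (apply_dual \<mu> f) + e" if e: "0 < e" for f e
  proof -
    obtain h where h: "h \<in> coboundaries" "\<And>x. Re (apply_bcontfun (f + h) x) \<le> Re (apply_dual \<mu> f) + e / 2"
      using uniquely_ergodic_upper_bound[OF uniq, of "e / 2" f] e by auto
    have "\<forall>\<^sub>F A in F. norm (A h) < e / 2"
      using tendstoD[OF right_ergodic_tendsto_coboundary[OF F h(1)], of "e / 2"] e by simp
    with cl show ?thesis
    proof eventually_elim
      case (elim A)
      show ?case
      proof
        fix x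
        have "Re (apply_bcontfun (A f) x) + Re (apply_bcontfun (A h) x) \<le> Re (apply_dual \<mu> f) + e / 2"
          using closure_co_Re_le[OF elim(1) h(2), of x] by (simp add: linear_add[OF closure_co_linear[OF elim(1)]])
        moreover have "\<bar>Re (apply_bcontfun (A h) x)\<bar> < e / 2"
          using abs_Re_le_cmod[of "apply_bcontfun (A h) x"] norm_bounded[of "A h" x] elim(2) by linarith
        ultimately show "Re (apply_bcontfun (A f) x) \<le> Re (apply_dual \<mu> f) + e" by linarith
      qed
    qed
  qed
  \<comment> \<open>the one-sided estimate for \<open>c f\<close>, as averages are complex linear\<close>
  have rotated: "\<forall>\<^sub>F A in F. \<forall>x. Re (c * (apply_bcontfun (A f) x - apply_dual \<mu> f)) \<le> e" if e: "0 < e" for c e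
    using cl one_sided[OF e, of "scaleC_bcontfun c f"]
  proof eventually_elim
    case (elim A)
    show ?case
    proof
      fix x
      show "Re (c * (apply_bcontfun (A f) x - apply_dual \<mu> f)) \<le> e"
        using elim(2)[rule_format, of x] unfolding closure_co_scaleC[OF elim(1)] apply_dual_scaleC
        by (simp add: right_diff_distrib)
    qed
  qed
  have "((\<lambda>A. A f) \<longlongrightarrow> const_bcontfun (apply_dual \<mu> f)) F"
  proof (rule tendstoI)
    fix e :: real assume e: "0 < e"
    then have e3: "0 < e / 3" by simp
    show "\<forall>\<^sub>F A in F. dist (A f) (const_bcontfun (apply_dual \<mu> f)) < e"
      using rotated[OF e3, of 1] rotated[OF e3, of "-1"] rotated[OF e3, of \<i>] rotated[OF e3, of "- \<i>"]
    proof eventually_elim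
      case (elim A)
      have "dist (A f) (const_bcontfun (apply_dual \<mu> f)) \<le> 2 * (e / 3)"
      proof (rule dist_bound)
        fix x
        define z where "z = apply_bcontfun (A f) x - apply_dual \<mu> f"
        have "\<bar>Re z\<bar> \<le> e / 3" "\<bar>Im z\<bar> \<le> e / 3"
          using elim[rule_format, of x] unfolding z_def[symmetric] by auto
        then have "norm z \<le> 2 * (e / 3)" using cmod_le[of z] by linarith
        then show "dist (apply_bcontfun (A f) x) (apply_bcontfun (const_bcontfun (apply_dual \<mu> f)) x) \<le> 2 * (e / 3)"
          by (simp add: dist_norm z_def)
      qed
      then show ?case using e by linarith
    qed
  qed
  then show "\<exists>l. ((\<lambda>A. A f) \<longlongrightarrow> l) F" by blast
qed

section \<open>Norm mean ergodicity implies weak* mean ergodicity\<close>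

lemma closure_dual_norm_le:
  assumes B: "B \<in> closure (operator_co (dual_koopman_semigroup act))"
    and K: "0 \<le> K" "\<And>f. norm (apply_dual \<mu> f) \<le> K * norm f"
  shows "norm (apply_dual (B \<mu>) f) \<le> K * norm f"
proof (rule closure_induct[OF B])
  have "continuous_on UNIV (\<lambda>B :: 'k cb_dual \<Rightarrow> 'k cb_dual. apply_dual (B \<mu>) f)"
    using continuous_on_compose2[OF continuous_apply_dual continuous_on_product_coordinates[of \<mu>]] by simp
  then show "closed {B :: 'k cb_dual \<Rightarrow> 'k cb_dual. norm (apply_dual (B \<mu>) f) \<le> K * norm f}"
    by (intro closed_Collect_le continuous_intros)
  fix B assume B: "B \<in> operator_co (dual_koopman_semigroup act)"
  have "B \<mu> \<in> (\<lambda>\<nu>. apply_dual \<nu> f) -` cball 0 (K * norm f)"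
  proof (rule operator_co_in_convex[OF B])
    fix U assume "U \<in> dual_koopman_semigroup act"
    then obtain s where U: "U = dual_operator (T s)"
      by (auto simp: dual_koopman_semigroup_def koopman_semigroup_def)
    have "norm (apply_dual \<mu> (T s f)) \<le> K * norm (T s f)" by (rule K(2))
    also have "\<dots> \<le> K * norm f" using norm_T_le K(1) by (rule mult_left_mono)
    finally show "U \<mu> \<in> (\<lambda>\<nu>. apply_dual \<nu> f) -` cball 0 (K * norm f)"
      by (simp add: U apply_dual_koopman[OF tds])
  qed (rule convex_linear_vimage[OF linear_eval_dual convex_cball])
  then show "norm (apply_dual (B \<mu>) f) \<le> K * norm f" by simp
qed

text \<open>Averages of adjoint Koopman operators do not change the values of a functional on invariant functions,
  and neither do their weak* limits.\<close>

lemma closure_dual_fixed: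
  assumes B: "B \<in> closure (operator_co (dual_koopman_semigroup act))" and f: "\<And>s. T s f = f"
  shows "apply_dual (B \<mu>) f = apply_dual \<mu> f"
proof (rule closure_induct[OF B])
  have "continuous_on UNIV (\<lambda>B :: 'k cb_dual \<Rightarrow> 'k cb_dual. apply_dual (B \<mu>) f)"
    using continuous_on_compose2[OF continuous_apply_dual continuous_on_product_coordinates[of \<mu>]] by simp
  then show "closed {B :: 'k cb_dual \<Rightarrow> 'k cb_dual. apply_dual (B \<mu>) f = apply_dual \<mu> f}"
    by (intro closed_Collect_eq continuous_intros)
  fix B assume B: "B \<in> operator_co (dual_koopman_semigroup act)"
  have "B \<mu> \<in> (\<lambda>\<nu>. apply_dual \<nu> f) -` {apply_dual \<mu> f}"
  proof (rule operator_co_in_convex[OF B])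
    fix U assume "U \<in> dual_koopman_semigroup act"
    then show "U \<mu> \<in> (\<lambda>\<nu>. apply_dual \<nu> f) -` {apply_dual \<mu> f}"
      by (auto simp: dual_koopman_semigroup_def koopman_semigroup_def apply_dual_koopman[OF tds] f)
  qed (rule convex_linear_vimage[OF linear_eval_dual convex_singleton])
  then show "apply_dual (B \<mu>) f = apply_dual \<mu> f" by simp
qed

text \<open>On coboundaries this is the definition of a left ergodic net. The closure is reached because the
  functionals \<open>B \<mu>\<close> are bounded uniformly in \<open>B\<close>.\<close>

lemma left_ergodic_tendsto_coboundary:
  assumes G: "left_ergodic_net (dual_koopman_semigroup act) G" and g: "g \<in> closure coboundaries"
  shows "((\<lambda>B. apply_dual (B \<mu>) g) \<longlongrightarrow> 0) G"
proof -
  have zero: "((\<lambda>B. apply_dual (B \<mu>) g) \<longlongrightarrow> 0) G" if "g \<in> coboundaries" for g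
    using that unfolding coboundaries_def
  proof (induction rule: span_induct_alt)
    case base
    show ?case by (simp add: linear_0[OF linear_apply_dual])
  next
    case (step c x y)
    then obtain s f where x: "x = f - T s f" by auto
    have "((\<lambda>B. B \<mu> - dual_operator (T s) (B \<mu>)) \<longlongrightarrow> 0) G"
      using G by (auto simp: left_ergodic_net_def dual_koopman_semigroup_def koopman_semigroup_def)
    then have "((\<lambda>B. apply_dual (B \<mu>) x) \<longlongrightarrow> 0) G"
      unfolding tendsto_cb_dual_iff x
      by (simp add: apply_dual_koopman[OF tds] linear_diff[OF linear_apply_dual])
    then have "((\<lambda>B. c *\<^sub>R apply_dual (B \<mu>) x + apply_dual (B \<mu>) y) \<longlongrightarrow> c *\<^sub>R 0 + 0) G"
      by (intro tendsto_intros step.IH)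
    then show ?case by (simp add: apply_dual_add apply_dual_scaleR_arg)
  qed
  obtain K where K: "0 \<le> K" "\<And>f. norm (apply_dual \<mu> f) \<le> K * norm f"
    using bounded_linear.nonneg_bounded[OF bounded_linear_apply_dual[of \<mu>]] by (auto simp: mult.commute)
  show ?thesis
  proof (rule tendstoI)
    fix e :: real assume e: "0 < e"
    obtain h where h: "h \<in> coboundaries" "dist h g < e / 2 / (K + 1)"
      using g e K(1) unfolding closure_approachable by (metis add_nonneg_pos divide_pos_pos zero_less_numeral zero_less_one)
    have small: "K * norm (g - h) \<le> e / 2"
    proof -
      have "K * norm (g - h) \<le> (K + 1) * norm (g - h)" by (simp add: mult_right_mono)
      also have "\<dots> \<le> e / 2"
        using h(2) K(1) by (simp add: dist_norm norm_minus_commute field_simps)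
      finally show ?thesis .
    qed
    have "\<forall>\<^sub>F B in G. B \<in> closure (operator_co (dual_koopman_semigroup act))"
      using G by (simp add: left_ergodic_net_def)
    moreover have "\<forall>\<^sub>F B in G. norm (apply_dual (B \<mu>) h) < e / 2"
      using tendstoD[OF zero[OF h(1)], of "e / 2"] e by simp
    ultimately show "\<forall>\<^sub>F B in G. dist (apply_dual (B \<mu>) g) 0 < e"
    proof eventually_elim
      case (elim B)
      have "apply_dual (B \<mu>) g = apply_dual (B \<mu>) h + apply_dual (B \<mu>) (g - h)"
        by (simp add: linear_diff[OF linear_apply_dual])
      moreover have "norm (apply_dual (B \<mu>) (g - h)) \<le> e / 2"
        using closure_dual_norm_le[OF elim(1) K, of "g - h"] small by linarith
      ultimately show ?case
        using elim(2) norm_triangle_ineq[of "apply_dual (B \<mu>) h" "apply_dual (B \<mu>) (g - h)"] by simp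
    qed
  qed
qed

end

context amenable_system begin

theorem norm_mean_ergodic_imp_weak_star_mean_ergodic:
  assumes nme: "norm_mean_ergodic act"
  shows "weak_star_mean_ergodic act"
proof -
  obtain F where F: "right_ergodic_net (koopman_semigroup act) F" "\<forall>\<^sub>F A in F. A \<in> co \<and> A \<in> UNIV"
    by (rule right_ergodic_net_exists[of UNIV]) (use T_in_co in auto)
  have Fne: "F \<noteq> bot" using F(1) by (simp add: right_ergodic_net_def)
  have conv: "\<exists>l. ((\<lambda>A. A f) \<longlongrightarrow> l) G" if "right_ergodic_net (koopman_semigroup act) G" for f G
    using nme that by (simp add: norm_mean_ergodic_def right_mean_ergodic_def)
  then obtain P where P: "\<And>f. ((\<lambda>A. A f) \<longlongrightarrow> P f) F" using F(1) by metis
  have P_fixed: "T s (P f) = P f" for s f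
  proof -
    \<comment> \<open>\<open>(T\<^sub>s A)\<close> is right ergodic too, and the union of both nets has a single limit at \<open>f\<close>\<close>
    define G where "G = filtermap (\<lambda>A f. T s (A f)) F"
    have blT: "bounded_linear (T s)"
      by (rule bounded_linear_intro[where K = 1])
        (simp_all add: linear_add[OF linear_T] linear_scale[OF linear_T] norm_T_le)
    have "right_ergodic_net (koopman_semigroup act) G"
      unfolding right_ergodic_net_def
    proof (intro conjI allI ballI)
      show "G \<noteq> bot" using Fne by (simp add: G_def filtermap_bot_iff)
      show "\<forall>\<^sub>F A in G. A \<in> closure (operator_co (koopman_semigroup act))"
        unfolding G_def eventually_filtermap co_def[symmetric] using F(2)
      proof (rule eventually_mono)
        fix A assume "A \<in> co \<and> A \<in> UNIV"
        then have "(\<lambda>f. T s (A f)) \<in> co" by (intro co_comp[OF T_in_co]) simp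
        then show "(\<lambda>f. T s (A f)) \<in> closure co" using closure_subset by blast
      qed
      fix f U assume "U \<in> koopman_semigroup act"
      then have "((\<lambda>A. A (f - U f)) \<longlongrightarrow> 0) F" using F(1) by (simp add: right_ergodic_net_def)
      then have "((\<lambda>A. T s (A (f - U f))) \<longlongrightarrow> T s 0) F" by (rule bounded_linear.tendsto[OF blT])
      then show "((\<lambda>A. A (f - U f)) \<longlongrightarrow> 0) G"
        by (simp add: G_def filterlim_filtermap linear_0[OF linear_T])
    qed
    then obtain l where l: "((\<lambda>A. A f) \<longlongrightarrow> l) (sup F G)"
      using conv right_ergodic_net_sup[OF F(1)] by blast
    have lF: "((\<lambda>A. A f) \<longlongrightarrow> l) F"
      by (rule tendsto_mono[OF sup_ge1 l])
    have "((\<lambda>A. A f) \<longlongrightarrow> l) G"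
      by (rule tendsto_mono[OF sup_ge2 l])
    then have "((\<lambda>A. T s (A f)) \<longlongrightarrow> l) F"
      by (simp add: G_def filterlim_filtermap)
    moreover have "((\<lambda>A. T s (A f)) \<longlongrightarrow> T s (P f)) F" by (rule bounded_linear.tendsto[OF blT P])
    ultimately have "T s (P f) = l" by (rule tendsto_unique[OF Fne, rotated])
    also have "l = P f" by (rule tendsto_unique[OF Fne lF P])
    finally show ?thesis .
  qed
  have P_diff: "f - P f \<in> closure coboundaries" for f
  proof (rule Lim_in_closed_set[OF closed_closure _ Fne])
    show "((\<lambda>A. f - A f) \<longlongrightarrow> f - P f) F" by (intro tendsto_intros P)
    show "\<forall>\<^sub>F A in F. f - A f \<in> closure coboundaries"
      using F(2) by (rule eventually_mono) (use diff_co_coboundary closure_subset in blast)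
  qed
  show ?thesis
    unfolding weak_star_mean_ergodic_def left_mean_ergodic_def
  proof (intro allI impI)
    fix G and \<mu> :: "'k cb_dual" assume G: "left_ergodic_net (dual_koopman_semigroup act) G"
    then have Gne: "G \<noteq> bot" and cl: "\<forall>\<^sub>F B in G. B \<in> closure (operator_co (dual_koopman_semigroup act))"
      by (simp_all add: left_ergodic_net_def)
    obtain K where K: "0 \<le> K" "\<And>f. norm (apply_dual \<mu> f) \<le> K * norm f"
      using bounded_linear.nonneg_bounded[OF bounded_linear_apply_dual[of \<mu>]] by (auto simp: mult.commute)
    have "((\<lambda>B. apply_dual (B \<mu>) f) \<longlongrightarrow> apply_dual \<mu> (P f)) G" for f
    proof -
      have "((\<lambda>B. apply_dual \<mu> (P f) + apply_dual (B \<mu>) (f - P f)) \<longlongrightarrow> apply_dual \<mu> (P f) + 0) G"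
        by (intro tendsto_intros left_ergodic_tendsto_coboundary[OF G P_diff])
      moreover have "\<forall>\<^sub>F B in G. apply_dual \<mu> (P f) + apply_dual (B \<mu>) (f - P f) = apply_dual (B \<mu>) f"
        using cl by (rule eventually_mono) (simp add: closure_dual_fixed P_fixed linear_diff[OF linear_apply_dual])
      ultimately show ?thesis by (simp add: tendsto_cong)
    qed
    then have "((\<lambda>B. B \<mu>) \<longlongrightarrow> Abs_dual (\<lambda>f. apply_dual \<mu> (P f))) G"
      by (rule tendsto_Abs_dual_pointwise_limit[OF Gne])
        (rule eventually_mono[OF cl], rule closure_dual_norm_le[OF _ K])
    then show "\<exists>l. ((\<lambda>B. B \<mu>) \<longlongrightarrow> l) G" by blast
  qed
qed

section \<open>Weak* mean ergodic transitive systems are uniquely ergodic\<close>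

lemma invariant_probability_exists_amenable:
  obtains \<mu> :: "'k cb_dual" where "is_probability_measure \<mu>" "\<And>s. dual_operator (T s) \<mu> = \<mu>"
proof -
  \<comment> \<open>the evaluation at an arbitrary point\<close>
  define \<phi> where "\<phi> f = Re (apply_bcontfun f undefined)" for f :: "'k \<Rightarrow>\<^sub>C complex"
  have "bounded_linear \<phi>"
    unfolding \<phi>_def
    by (rule bounded_linear_intro[where K = 1]) (auto intro: order_trans[OF abs_Re_le_cmod norm_bounded])
  then obtain \<Phi> where \<Phi>: "linear \<Phi>" "\<And>s f. \<Phi> (T s f) = \<Phi> f"
      "\<And>f c. (\<And>s. \<phi> (T s f) \<le> c) \<Longrightarrow> \<Phi> f \<le> c"
    by (rule invariant_average) blast
  have "\<Phi> f \<le> c" if "\<And>x. Re (apply_bcontfun f x) \<le> c" for f c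
    using that by (intro \<Phi>(3)) (simp add: \<phi>_def)
  then show ?thesis
    by (rule invariant_probability_exists[OF \<Phi>(1) _ \<Phi>(2)]) (use that in blast)+
qed

text \<open>If all translates of \<open>Re (A f)\<close> were at least \<open>Re \<mu>(f) + e\<close> at \<open>x\<close>, then \<open>Re (A f)\<close> would be at least this
  large on the orbit of \<open>x\<close> and, by density, everywhere, so that \<open>Re \<mu>(A f) \<ge> Re \<mu>(f) + e\<close>. But
  \<open>\<mu>(A f) = \<mu>(f)\<close> by invariance.\<close>

lemma right_ergodic_net_below:
  assumes dense: "closure (range (\<lambda>s. act s x)) = UNIV"
    and \<mu>: "is_probability_measure \<mu>" "\<And>s. dual_operator (T s) \<mu> = \<mu>" and e: "0 < e"
  obtains F where "right_ergodic_net (koopman_semigroup act) F"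
    "\<forall>\<^sub>F A in F. A \<in> co \<and> Re (apply_bcontfun (A f) x) \<le> Re (apply_dual \<mu> f) + e"
proof -
  have inv: "apply_dual \<mu> (A f) = apply_dual \<mu> f" if "A \<in> co" for A
  proof -
    have "A f \<in> apply_dual \<mu> -` {apply_dual \<mu> f}"
    proof (rule co_in_convex[OF that convex_linear_vimage[OF linear_apply_dual convex_singleton]])
      show "T s f \<in> apply_dual \<mu> -` {apply_dual \<mu> f}" for s
        using apply_dual_koopman[OF tds, of s \<mu> f] by (simp add: \<mu>(2))
    qed
    then show ?thesis by simp
  qed
  define C where "C = {A. Re (apply_bcontfun (A f) x) \<le> Re (apply_dual \<mu> f) + e}"
  have "\<exists>D\<in>co. (\<lambda>f. D (A f)) \<in> C" if A: "A \<in> co" for A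
  proof (rule ccontr)
    assume "\<not> ?thesis"
    then have "(\<lambda>f. T s (A f)) \<notin> C" for s
      using T_in_co by blast
    then have gt: "Re (apply_dual \<mu> f) + e \<le> Re (apply_bcontfun (A f) (act s x))" for s
      by (simp add: C_def not_le less_imp_le)
    have "closed {y. Re (apply_dual \<mu> f) + e \<le> Re (apply_bcontfun (A f) y)}"
      by (intro closed_Collect_le continuous_intros continuous_on_apply_bcontfun)
    then have "closure (range (\<lambda>s. act s x)) \<subseteq> {y. Re (apply_dual \<mu> f) + e \<le> Re (apply_bcontfun (A f) y)}"
      by (rule closure_minimal[rotated]) (use gt in auto)
    then have ge: "Re (apply_dual \<mu> f) + e \<le> Re (apply_bcontfun (A f) y)" for y
      unfolding dense by auto
    have "Re (apply_dual \<mu> (- A f)) \<le> - (Re (apply_dual \<mu> f) + e)"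
    proof (rule probability_measure_Re_le[OF \<mu>(1)])
      show "Re (apply_bcontfun (- A f) y) \<le> - (Re (apply_dual \<mu> f) + e)" for y
        using ge[of y] by simp
    qed
    then show False
      using e by (simp add: linear_neg[OF linear_apply_dual] inv[OF A])
  qed
  then obtain F where "right_ergodic_net (koopman_semigroup act) F" "\<forall>\<^sub>F A in F. A \<in> co \<and> A \<in> C"
    by (rule right_ergodic_net_exists)
  with that show ?thesis by (simp add: C_def)
qed

theorem weak_star_mean_ergodic_imp_uniquely_ergodic:
  assumes trans: "topologically_transitive act" and wme: "weak_star_mean_ergodic act"
  shows "uniquely_ergodic act"
proof -
  obtain x where dense: "closure (range (\<lambda>s. act s x)) = UNIV"
    using trans by (auto simp: topologically_transitive_def)
  define \<delta> where "\<delta> = Abs_dual (\<lambda>f :: 'k \<Rightarrow>\<^sub>C complex. apply_bcontfun f x)"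
  have \<delta>: "apply_dual \<delta> f = apply_bcontfun f x" for f
    unfolding \<delta>_def by (subst apply_dual_Abs_dual[where B = 1]) (auto simp: norm_bounded)
  have le: "Re (apply_dual \<nu> f) \<le> Re (apply_dual \<mu> f)"
    if \<mu>: "is_probability_measure \<mu>" "\<And>s. dual_operator (T s) \<mu> = \<mu>"
      and \<nu>: "is_probability_measure \<nu>" "\<And>s. dual_operator (T s) \<nu> = \<nu>" for \<mu> \<nu> f
  proof (rule field_le_epsilon)
    fix e :: real assume e: "0 < e"
    then have e2: "0 < e / 2" by simp
    obtain F where F: "right_ergodic_net (koopman_semigroup act) F"
      "\<forall>\<^sub>F A in F. A \<in> co \<and> Re (apply_bcontfun (A f) x) \<le> Re (apply_dual \<mu> f) + e / 2"
      by (rule right_ergodic_net_below[OF dense \<mu> e2])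
    obtain G where G: "right_ergodic_net (koopman_semigroup act) G"
      "\<forall>\<^sub>F A in G. A \<in> co \<and> Re (apply_bcontfun (A (- f)) x) \<le> Re (apply_dual \<nu> (- f)) + e / 2"
      by (rule right_ergodic_net_below[OF dense \<nu> e2])
    have coF: "\<forall>\<^sub>F A in F. A \<in> co" and coG: "\<forall>\<^sub>F A in G. A \<in> co"
      using F(2) G(2) by (auto elim: eventually_mono)
    have "left_ergodic_net (dual_koopman_semigroup act) (sup (filtermap dual_operator F) (filtermap dual_operator G))"
      by (intro left_ergodic_net_sup dual_ergodic_net F(1) G(1) coF coG)
    then obtain l where l: "((\<lambda>B. B \<delta>) \<longlongrightarrow> l) (sup (filtermap dual_operator F) (filtermap dual_operator G))"
      using wme unfolding weak_star_mean_ergodic_def left_mean_ergodic_def by blast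
    have lim: "((\<lambda>A. Re (apply_bcontfun (A f) x)) \<longlongrightarrow> Re (apply_dual l f)) H"
      if H: "H = F \<or> H = G" and coH: "\<forall>\<^sub>F A in H. A \<in> co" for H
    proof -
      have "filtermap dual_operator H \<le> sup (filtermap dual_operator F) (filtermap dual_operator G)"
        using H by auto
      from tendsto_mono[OF this l] have "((\<lambda>A. dual_operator A \<delta>) \<longlongrightarrow> l) H"
        by (simp add: filterlim_filtermap)
      then have "((\<lambda>A. apply_dual (dual_operator A \<delta>) f) \<longlongrightarrow> apply_dual l f) H"
        by (simp add: tendsto_cb_dual_iff)
      moreover have "\<forall>\<^sub>F A in H. apply_dual (dual_operator A \<delta>) f = apply_bcontfun (A f) x"
        using coH by (rule eventually_mono) (simp add: apply_dual_co \<delta>)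
      ultimately have "((\<lambda>A. apply_bcontfun (A f) x) \<longlongrightarrow> apply_dual l f) H" by (simp add: tendsto_cong)
      then show ?thesis by (rule tendsto_Re)
    qed
    have "Re (apply_dual l f) \<le> Re (apply_dual \<mu> f) + e / 2"
    proof (rule tendsto_upperbound[OF lim[of F]])
      show "\<forall>\<^sub>F A in F. Re (apply_bcontfun (A f) x) \<le> Re (apply_dual \<mu> f) + e / 2"
        using F(2) by (auto elim: eventually_mono)
      show "F \<noteq> bot" using F(1) by (simp add: right_ergodic_net_def)
    qed (simp_all add: coF)
    moreover have "Re (apply_dual \<nu> f) - e / 2 \<le> Re (apply_dual l f)"
    proof (rule tendsto_lowerbound[OF lim[of G]])
      show "\<forall>\<^sub>F A in G. Re (apply_dual \<nu> f) - e / 2 \<le> Re (apply_bcontfun (A f) x)"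
        using G(2) by (rule eventually_mono)
          (auto simp: linear_neg[OF linear_co] linear_neg[OF linear_apply_dual])
      show "G \<noteq> bot" using G(1) by (simp add: right_ergodic_net_def)
    qed (simp_all add: coG)
    ultimately show "Re (apply_dual \<nu> f) \<le> Re (apply_dual \<mu> f) + e" by simp
  qed
  obtain \<mu> :: "'k cb_dual" where \<mu>: "is_probability_measure \<mu>" "\<And>s. dual_operator (T s) \<mu> = \<mu>"
    by (rule invariant_probability_exists_amenable) blast
  show ?thesis
    unfolding uniquely_ergodic_def
  proof (rule ex1I[of _ \<mu>])
    show "is_probability_measure \<mu> \<and> (\<forall>s. dual_operator (T s) \<mu> = \<mu>)" using \<mu> by blast
    fix \<nu> assume "is_probability_measure \<nu> \<and> (\<forall>s. dual_operator (T s) \<nu> = \<nu>)"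
    then have \<nu>: "is_probability_measure \<nu>" "\<And>s. dual_operator (T s) \<nu> = \<nu>"
      by auto
    show "\<nu> = \<mu>"
      by (rule cb_dual_eq_if_Re, rule antisym) (rule le[OF \<mu> \<nu>], rule le[OF \<nu> \<mu>])
  qed
qed

end

theorem theorem5p6:
  fixes act :: "'s::semitopological_semigroup \<Rightarrow> 'k::t2_space \<Rightarrow> 'k"
  assumes "topological_dynamical_system act"
    and "left_amenable TYPE('s)"
  shows "(uniquely_ergodic act \<longrightarrow> norm_mean_ergodic act) \<and>
         (norm_mean_ergodic act \<longrightarrow> weak_star_mean_ergodic act) \<and>
         (topologically_transitive act \<longrightarrow>
            (weak_star_mean_ergodic act \<longleftrightarrow> norm_mean_ergodic act) \<and>
            (norm_mean_ergodic act \<longleftrightarrow> uniquely_ergodic act))"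
proof -
  interpret amenable_system act
    using assms by unfold_locales
  show ?thesis
    using uniquely_ergodic_imp_norm_mean_ergodic norm_mean_ergodic_imp_weak_star_mean_ergodic
      weak_star_mean_ergodic_imp_uniquely_ergodic
    by blast
qed

end
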